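(* Let $K$ be an algebraically closed field of characteristic zero, let $d\geq 5$ and $3\le \ell\le d-1$ be integers with $d\equiv 1\pmod{\ell}$, and let $C\subset\mathbb{P}^2(K)$ be a non-singular plane curve of degree $d$. Assume that $Aut(C)$ contains a cyclic group of order $\ell d$. Then $C$ is isomorphic to a curve of the form $$\tilde{C}:\ X^d+Y^d+\alpha XZ^{d-1}+\sum_{2\leq j=\ell m\leq d-2}\beta_{j0}X^{d-j}Z^{j}=0,$$ where $\alpha\in K$, $\alpha\neq 0$, the $\beta_{j0}$ are in $K$, and the sum runs over the multiples $j=\ell m$ of $\ell$ with $2\le j\le d-2$. In particular, in these coordinates, the automorphism group consists of elements of the form $[\alpha_1X+\alpha_3Z;\,Y;\,\gamma_1X+\gamma_2Z]$.
   Context: $Aut(C)$ is the full automorphism group of $C$ over $K$, identified with the finite subgroup of $PGL_3(K)$ preserving the defining equation of $C$. The notation $[L_1;L_2;L_3]$, with $L_i$ linear forms in $X,Y,Z$, denotes the projective transformation $(X:Y:Z)\mapsto(L_1:L_2:L_3)$. *)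

theory Defs
  imports
    "HOL-Analysis.Cartesian_Space"
    "HOL-Analysis.Determinants"
    "HOL-Algebra.Elementary_Groups"
    "HOL-Computational_Algebra.Polynomial"
    "HOL-Library.Poly_Mapping"
    "HOL-Number_Theory.Cong"
begin

section \<open>Polynomials in three variables\<close>

text \<open>
  The variables \<open>X\<close>, \<open>Y\<close>, \<open>Z\<close> are \<open>var 1\<close>, \<open>var 2\<close>, \<open>var 3\<close>; in the index type \<open>3\<close>, the
  numeral \<open>3\<close> is the element \<open>0\<close>, distinct from \<open>1\<close> and \<open>2\<close>, as usual for \<open>'a ^ 3\<close>.
\<close>

type_synonym 'a poly3 = "(3 \<Rightarrow>\<^sub>0 nat) \<Rightarrow>\<^sub>0 'a"

definition const :: "'a::zero \<Rightarrow> 'a poly3"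
  where "const c = Poly_Mapping.single 0 c"

definition var :: "3 \<Rightarrow> 'a::zero_neq_one poly3"
  where "var i = Poly_Mapping.single (Poly_Mapping.single i 1) 1"

definition peval ::
  "('a::zero \<Rightarrow> 'b::comm_semiring_1) \<Rightarrow> (3 \<Rightarrow> 'b) \<Rightarrow> 'a poly3 \<Rightarrow> 'b"
  where "peval h x F =
    (\<Sum>m\<in>Poly_Mapping.keys F.
       h (Poly_Mapping.lookup F m) * (\<Prod>i\<in>UNIV. x i ^ Poly_Mapping.lookup m i))"

abbreviation eval3 :: "'a::comm_semiring_1 poly3 \<Rightarrow> 'a ^ 3 \<Rightarrow> 'a"
  where "eval3 F v \<equiv> peval (\<lambda>c. c) (($) v) F"

text \<open>The polynomial \<open>F(L\<^sub>1, L\<^sub>2, L\<^sub>3)\<close>, where row \<open>i\<close> of \<open>A\<close> lists the coefficients of \<open>L\<^sub>i\<close>.\<close>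

definition lin_subst :: "'a::comm_semiring_1 ^ 3 ^ 3 \<Rightarrow> 'a poly3 \<Rightarrow> 'a poly3"
  where "lin_subst A F = peval const (\<lambda>i. \<Sum>j\<in>UNIV. const (A $ i $ j) * var j) F"

text \<open>If \<open>i\<close> does not occur in \<open>m\<close>, the truncated difference is harmless: the coefficient is 0.\<close>

definition pderiv3 :: "3 \<Rightarrow> 'a::comm_semiring_1 poly3 \<Rightarrow> 'a poly3"
  where "pderiv3 i F =
    (\<Sum>m\<in>Poly_Mapping.keys F.
       Poly_Mapping.single (m - Poly_Mapping.single i 1)
         (of_nat (Poly_Mapping.lookup m i) * Poly_Mapping.lookup F m))"

definition homogeneous3 :: "nat \<Rightarrow> 'a::zero poly3 \<Rightarrow> bool"
  where "homogeneous3 d F \<longleftrightarrow>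
    (\<forall>m\<in>Poly_Mapping.keys F. (\<Sum>i\<in>UNIV. Poly_Mapping.lookup m i) = d)"

lemma const_hom [simp]:
  fixes a b :: "'a::comm_semiring_1"
  shows "const (0::'a) = 0" "const (1::'a) = 1"
    "const (a + b) = const a + const b" "const (a * b) = const a * const b"
  by (simp_all add: const_def single_add mult_single)

lemma const_sum [simp]:
  fixes f :: "'b \<Rightarrow> 'a::comm_semiring_1"
  shows "const (\<Sum>i\<in>I. f i) = (\<Sum>i\<in>I. const (f i))"
  by (induction I rule: infinite_finite_induct) auto

locale coeff_hom =
  fixes h :: "'a::comm_semiring_1 \<Rightarrow> 'b::comm_semiring_1"
  assumes hom_zero: "h 0 = 0" and hom_one: "h 1 = 1"
    and hom_add: "h (a + b) = h a + h b" and hom_mult: "h (a * b) = h a * h b"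
begin

lemma peval_superset:
  assumes "finite S" "Poly_Mapping.keys F \<subseteq> S"
  shows "peval h x F =
    (\<Sum>m\<in>S. h (Poly_Mapping.lookup F m) * (\<Prod>i\<in>UNIV. x i ^ Poly_Mapping.lookup m i))"
  unfolding peval_def
  by (rule sum.mono_neutral_left) (use assms in \<open>auto simp: hom_zero not_in_keys_iff_lookup_eq_zero\<close>)

lemma peval_0 [simp]: "peval h x 0 = 0"
  by (simp add: peval_def)

lemma peval_add [simp]: "peval h x (F + G) = peval h x F + peval h x G"
proof -
  let ?S = "Poly_Mapping.keys F \<union> Poly_Mapping.keys G"
  have "Poly_Mapping.keys (F + G) \<subseteq> ?S"
    by (rule Poly_Mapping.keys_add)
  then show ?thesis
    by (simp add: peval_superset[of ?S] lookup_add hom_add sum.distrib distrib_right)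
qed

lemma peval_sum [simp]: "peval h x (\<Sum>i\<in>I. f i) = (\<Sum>i\<in>I. peval h x (f i))"
  by (induction I rule: infinite_finite_induct) auto

lemma peval_single:
  "peval h x (Poly_Mapping.single m c) = h c * (\<Prod>i\<in>UNIV. x i ^ Poly_Mapping.lookup m i)"
  by (subst peval_superset[of "{m}"]) (auto simp: hom_zero)

lemma peval_const [simp]: "peval h x (const c) = h c"
  by (simp add: const_def peval_single)

lemma peval_var [simp]: "peval h x (var j) = x j"
proof -
  have "(\<Prod>i\<in>UNIV. x i ^ Poly_Mapping.lookup (Poly_Mapping.single j 1) i)
      = (\<Prod>i\<in>UNIV. if i = j then x i else 1)"
    by (intro prod.cong) (auto simp: lookup_single)
  then show ?thesis
    by (simp add: var_def peval_single hom_one)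
qed

lemma poly3_as_sum:
  "(F :: 'a poly3) =
    (\<Sum>m\<in>Poly_Mapping.keys F. Poly_Mapping.single m (Poly_Mapping.lookup F m))"
  by (intro poly_mapping_eqI)
     (auto simp: lookup_sum lookup_single when_def not_in_keys_iff_lookup_eq_zero)

lemma peval_mult [simp]: "peval h x (F * G) = peval h x F * peval h x G"
proof -
  have *: "F * G = (\<Sum>m\<in>Poly_Mapping.keys F. \<Sum>n\<in>Poly_Mapping.keys G.
      Poly_Mapping.single (m + n) (Poly_Mapping.lookup F m * Poly_Mapping.lookup G n))"
    by (subst poly3_as_sum[of F], subst poly3_as_sum[of G])
       (simp add: sum_product mult_single)
  show ?thesis
    unfolding * peval_sum peval_single
    by (simp add: peval_def sum_product hom_mult lookup_add power_add prod.distrib mult_ac)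
qed

lemma peval_1 [simp]: "peval h x 1 = 1"
  using peval_const[of x 1] by (simp add: hom_one)

lemma peval_power [simp]: "peval h x (F ^ n) = peval h x F ^ n"
  by (induction n) auto

lemma peval_prod [simp]: "peval h x (\<Prod>i\<in>I. f i) = (\<Prod>i\<in>I. peval h x (f i))"
  by (induction I rule: infinite_finite_induct) auto

lemma peval_peval_const:
  "peval h x (peval const y F) = peval h (\<lambda>i. peval h x (y i)) F"
  unfolding peval_def[of const] by (simp add: peval_def[of h _ F])

end

interpretation const: coeff_hom const
  by unfold_locales simp_all

interpretation id_hom: coeff_hom "\<lambda>c. c"
  by unfold_locales simp_all

lemma var_power: "(var i :: 'a::comm_semiring_1 poly3) ^ k =
    Poly_Mapping.single (Poly_Mapping.single i k) 1"
proof (induction k)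
  case (Suc k)
  have "Poly_Mapping.single i (Suc k) = Poly_Mapping.single i 1 + Poly_Mapping.single i k"
    using single_add[of i 1 k] by simp
  moreover have "(var i :: 'a poly3) ^ Suc k
      = Poly_Mapping.single (Poly_Mapping.single i 1 + Poly_Mapping.single i k) 1"
    by (simp only: power_Suc Suc) (simp add: var_def mult_single)
  ultimately show ?case
    by simp
qed simp

lemma peval_const_var: "peval const var F = F"
proof -
  have single_prod: "(\<Prod>i\<in>I. Poly_Mapping.single (f i) (1::'a)) = Poly_Mapping.single (\<Sum>i\<in>I. f i) 1"
    for f :: "3 \<Rightarrow> 3 \<Rightarrow>\<^sub>0 nat" and I
    by (induction I rule: infinite_finite_induct) (simp_all add: mult_single)
  have monom: "(\<Sum>i\<in>UNIV. Poly_Mapping.single i (Poly_Mapping.lookup m i)) = m" for m :: "3 \<Rightarrow>\<^sub>0 nat"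
    by (intro poly_mapping_eqI) (simp add: lookup_sum lookup_single when_def)
  show ?thesis
    unfolding peval_def var_power single_prod monom
    by (subst (3) const.poly3_as_sum) (simp add: const_def mult_single)
qed

lemma eval3_lin_subst: "eval3 (lin_subst A F) v = eval3 F (A *v v)"
proof -
  have "(\<lambda>i. \<Sum>j\<in>UNIV. A $ i $ j * v $ j) = ($) (A *v v)"
    by (simp add: matrix_vector_mult_def fun_eq_iff)
  then show ?thesis
    by (simp add: lin_subst_def id_hom.peval_peval_const)
qed

lemma lin_subst_lin_subst: "lin_subst B (lin_subst A F) = lin_subst (A ** B) F"
proof -
  have "(\<Sum>j\<in>UNIV. const (A $ i $ j) * (\<Sum>k\<in>UNIV. const (B $ j $ k) * var k))
      = (\<Sum>k\<in>UNIV. const ((A ** B) $ i $ k) * var k)" for i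
    unfolding matrix_matrix_mult_def
    by (simp add: sum_distrib_left sum_distrib_right mult.assoc) (rule sum.swap)
  then show ?thesis
    by (simp add: lin_subst_def const.peval_peval_const)
qed

lemma lin_subst_const_mult: "lin_subst A (const c * F) = const c * lin_subst A F"
  by (simp add: lin_subst_def)


section \<open>The group \<open>PGL\<^sub>3(K)\<close>\<close>

definition GL3 :: "('a::field ^ 3 ^ 3) monoid"
  where "GL3 = \<lparr>carrier = {A. invertible A}, mult = (**), one = mat 1\<rparr>"

definition scalars3 :: "('a::field ^ 3 ^ 3) set"
  where "scalars3 = {mat c | c. c \<noteq> 0}"

definition PGL3 :: "('a::field ^ 3 ^ 3) set monoid"
  where "PGL3 = GL3 Mod scalars3"

text \<open>
  The class of \<open>A\<close> in \<open>PGL\<^sub>3(K)\<close>, written \<open>[L\<^sub>1; L\<^sub>2; L\<^sub>3]\<close> when the rows of \<open>A\<close> list the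
  coefficients of the linear forms \<open>L\<^sub>1, L\<^sub>2, L\<^sub>3\<close>: it acts by \<open>v \<mapsto> A *v v\<close> on points.
\<close>

definition proj_class :: "'a::field ^ 3 ^ 3 \<Rightarrow> ('a ^ 3 ^ 3) set"
  where "proj_class A = scalars3 #>\<^bsub>GL3\<^esub> A"

lemma mat_mult_left: "(mat c :: 'a::field ^ 3 ^ 3) ** A = (\<chi> i j. c * A $ i $ j)"
  by (simp add: mat_def matrix_matrix_mult_def vec_eq_iff if_distrib[of "\<lambda>x. x * y" for y]
      cong: if_cong)

lemma mat_mult_right: "A ** (mat c :: 'a::field ^ 3 ^ 3) = (\<chi> i j. c * A $ i $ j)"
  by (simp add: mat_def matrix_matrix_mult_def vec_eq_iff if_distrib[of "(*) y" for y]
      mult.commute cong: if_cong)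

lemma mat_commute: "(mat c :: 'a::field ^ 3 ^ 3) ** (A :: 'a ^ 3 ^ 3) = A ** mat c"
  by (simp only: mat_mult_left mat_mult_right)

lemma mat_mult: "(mat c :: 'a::field ^ 3 ^ 3) ** mat d = mat (c * d)"
  unfolding mat_mult_left by (simp add: mat_def vec_eq_iff)

lemma invertible_mat: "c \<noteq> 0 \<Longrightarrow> invertible (mat c :: 'a::field ^ 3 ^ 3)"
  unfolding invertible_def by (rule exI[of _ "mat (inverse c)"]) (simp add: mat_mult)

lemma group_GL3: "group GL3"
proof (rule groupI)
  fix A :: "'a ^ 3 ^ 3" assume "A \<in> carrier GL3"
  then show "\<exists>B\<in>carrier GL3. B \<otimes>\<^bsub>GL3\<^esub> A = \<one>\<^bsub>GL3\<^esub>"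
    by (auto simp: GL3_def invertible_def)
qed (auto simp: GL3_def matrix_mul_assoc invertible_mult invertible_mat)

lemma normal_scalars3: "scalars3 \<lhd> GL3"
proof (rule group.normalI[OF group_GL3])
  interpret group "GL3 :: ('a ^ 3 ^ 3) monoid" by (rule group_GL3)
  show "subgroup scalars3 (GL3 :: ('a ^ 3 ^ 3) monoid)"
  proof (rule subgroupI)
    fix A :: "'a ^ 3 ^ 3" assume "A \<in> scalars3"
    then obtain c where c: "c \<noteq> 0" "A = mat c" by (auto simp: scalars3_def)
    have "inv\<^bsub>GL3\<^esub> A = mat (inverse c)"
      using c by (intro inv_equality) (simp_all add: GL3_def mat_mult invertible_mat)
    then show "inv\<^bsub>GL3\<^esub> A \<in> scalars3"
      using c by (auto simp: scalars3_def)
  next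
    show "A \<otimes>\<^bsub>GL3\<^esub> B \<in> scalars3" if "A \<in> scalars3" "B \<in> scalars3" for A B :: "'a ^ 3 ^ 3"
      using that by (force simp: scalars3_def GL3_def mat_mult)
  qed (auto simp: scalars3_def GL3_def invertible_mat intro: exI[of _ 1])
  show "\<forall>A\<in>carrier (GL3 :: ('a ^ 3 ^ 3) monoid). scalars3 #>\<^bsub>GL3\<^esub> A = A <#\<^bsub>GL3\<^esub> scalars3"
    by (auto simp: r_coset_def l_coset_def scalars3_def GL3_def mat_commute)
qed

lemma group_PGL3: "group PGL3"
  unfolding PGL3_def by (rule normal.factorgroup_is_group[OF normal_scalars3])

lemma carrier_PGL3: "carrier PGL3 = {proj_class A | A. invertible A}"
  by (auto simp: PGL3_def carrier_FactGroup proj_class_def GL3_def)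

lemma mult_PGL3:
  "invertible A \<Longrightarrow> invertible B \<Longrightarrow> proj_class A \<otimes>\<^bsub>PGL3\<^esub> proj_class B = proj_class (A ** B)"
  using normal.rcos_sum[OF normal_scalars3, of A B]
  by (simp add: PGL3_def proj_class_def GL3_def)

lemma one_PGL3: "\<one>\<^bsub>PGL3\<^esub> = proj_class (mat 1)"
  by (auto simp: PGL3_def proj_class_def r_coset_def GL3_def)


section \<open>Plane curves\<close>

text \<open>
  A plane curve of degree \<open>d\<close> is given by its defining equation, a nonzero form of degree \<open>d\<close>.
\<close>

definition nonsingular_plane_curve :: "nat \<Rightarrow> 'a::field poly3 \<Rightarrow> bool"
  where "nonsingular_plane_curve d F \<longleftrightarrow>
    F \<noteq> 0 \<and> homogeneous3 d F \<and>
    (\<forall>v. v \<noteq> 0 \<and> eval3 F v = 0 \<longrightarrow> (\<exists>i. eval3 (pderiv3 i F) v \<noteq> 0))"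

text \<open>
  The defining equation is preserved up to a nonzero constant factor, a condition that does not
  depend on the matrix chosen to represent an element of \<open>PGL\<^sub>3(K)\<close>.
\<close>

definition preserves_curve :: "'a::field ^ 3 ^ 3 \<Rightarrow> 'a poly3 \<Rightarrow> bool"
  where "preserves_curve A F \<longleftrightarrow> (\<exists>c. c \<noteq> 0 \<and> lin_subst A F = const c * F)"

definition curve_aut :: "'a::field poly3 \<Rightarrow> ('a ^ 3 ^ 3) set monoid"
  where "curve_aut F =
    PGL3\<lparr>carrier := {proj_class A | A. invertible A \<and> preserves_curve A F}\<rparr>"

text \<open>
  Isomorphisms between non-singular plane curves of degree at least 4 are restrictions of
  projective transformations of the plane.
\<close>

definition curves_isomorphic :: "'a::field poly3 \<Rightarrow> 'a poly3 \<Rightarrow> bool"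
  where "curves_isomorphic F G \<longleftrightarrow>
    (\<exists>A c. invertible A \<and> c \<noteq> 0 \<and> lin_subst A F = const c * G)"

lemma lin_subst_mat1: "lin_subst (mat 1) F = F"
proof -
  have "(\<Sum>j\<in>UNIV. const (mat 1 $ i $ j) * var j) = (var i :: 'a poly3)" for i
    by (simp add: mat_def if_distrib[of const] if_distrib[of "\<lambda>x. x * y" for y] cong: if_cong)
  then show ?thesis
    by (simp add: lin_subst_def peval_const_var)
qed

lemma subgroup_curve_aut: "subgroup (carrier (curve_aut F)) PGL3"
proof (rule group.subgroupI[OF group_PGL3])
  let ?H = "carrier (curve_aut F)"
  have H: "?H = {proj_class A | A. invertible A \<and> preserves_curve A F}"
    by (simp add: curve_aut_def)
  have one: "preserves_curve (mat 1) F"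
    unfolding preserves_curve_def by (rule exI[of _ 1]) (simp add: lin_subst_mat1)
  show "?H \<subseteq> carrier PGL3"
    by (auto simp: H carrier_PGL3)
  show "?H \<noteq> {}"
    using one invertible_mat[of 1] by (auto simp: H)
  show "g \<otimes>\<^bsub>PGL3\<^esub> g' \<in> ?H" if "g \<in> ?H" "g' \<in> ?H" for g g'
  proof -
    from that obtain A B where *: "g = proj_class A" "invertible A" "preserves_curve A F"
      "g' = proj_class B" "invertible B" "preserves_curve B F" by (auto simp: H)
    then obtain a b where ab: "a \<noteq> 0" "b \<noteq> 0"
      "lin_subst A F = const a * F" "lin_subst B F = const b * F"
      by (auto simp: preserves_curve_def)
    have "lin_subst (A ** B) F = const (a * b) * F"
      by (simp add: lin_subst_lin_subst[symmetric] ab lin_subst_const_mult mult.assoc)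
    then have "preserves_curve (A ** B) F"
      unfolding preserves_curve_def using ab by (intro exI[of _ "a * b"]) simp
    then show ?thesis
      using * by (auto simp: H mult_PGL3 intro: invertible_mult)
  qed
  show "inv\<^bsub>PGL3\<^esub> g \<in> ?H" if "g \<in> ?H" for g
  proof -
    from that obtain A where *: "g = proj_class A" "invertible A" "preserves_curve A F"
      by (auto simp: H)
    then obtain a where a: "a \<noteq> 0" "lin_subst A F = const a * F"
      by (auto simp: preserves_curve_def)
    from * obtain B where B: "A ** B = mat 1" "B ** A = mat 1"
      by (auto simp: invertible_def)
    then have iB: "invertible B" by (auto simp: invertible_def)
    have "const a * lin_subst B F = F"
      using lin_subst_lin_subst[of B A F]
      by (simp add: B a lin_subst_const_mult lin_subst_mat1)
    then have "const (inverse a) * (const a * lin_subst B F) = const (inverse a) * F"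
      by simp
    then have "lin_subst B F = const (inverse a) * F"
      using a by (simp add: mult.assoc[symmetric] const_hom(4)[symmetric] del: const_hom(4))
    then have "preserves_curve B F"
      unfolding preserves_curve_def using a by (intro exI[of _ "inverse a"]) simp
    moreover have "inv\<^bsub>PGL3\<^esub> g = proj_class B"
      using * iB B by (intro group.inv_equality[OF group_PGL3])
        (auto simp: mult_PGL3 one_PGL3 carrier_PGL3)
    ultimately show ?thesis
      using iB by (auto simp: H)
  qed
qed

lemma group_curve_aut: "group (curve_aut F)"
  using subgroup.subgroup_is_group[OF subgroup_curve_aut group_PGL3, of F]
  by (simp add: curve_aut_def)

text \<open>The left-hand side of
  \<open>X\<^sup>d + Y\<^sup>d + \<alpha> X Z\<^sup>d\<^sup>-\<^sup>1 + \<Sum>\<^sub>j \<beta>\<^sub>j\<^sub>0 X\<^sup>d\<^sup>-\<^sup>j Z\<^sup>j = 0\<close>.\<close>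

definition C_tilde :: "nat \<Rightarrow> nat \<Rightarrow> 'a::field \<Rightarrow> (nat \<Rightarrow> 'a) \<Rightarrow> 'a poly3"
  where "C_tilde d l \<alpha> \<beta> =
    var 1 ^ d + var 2 ^ d + const \<alpha> * var 1 * var 3 ^ (d - 1)
    + (\<Sum>j\<in>{j. 2 \<le> j \<and> j \<le> d - 2 \<and> l dvd j}. const (\<beta> j) * var 1 ^ (d - j) * var 3 ^ j)"

end

theory Submission
  imports Defs "HOL-Algebra.Multiplicative_Group"
begin

text \<open>
  A generator of the cyclic group is represented by a matrix one of whose powers is a nonzero scalar,
  hence it is diagonal in suitable coordinates. Smoothness at a coordinate vertex \<open>P\<^sub>i\<close> forces
  the monomial \<open>X\<^sub>i\<^sup>d\<close> or some \<open>X\<^sub>i\<^sup>d\<^sup>-\<^sup>1 X\<^sub>k\<close> to occur in the equation, and each choice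
  of such monomials gives relations between the eigenvalues that bound the order of the automorphism.
  Since the order is \<open>l d\<close> with \<open>l\<close> dividing \<open>d - 1\<close>, only the monomials
  \<open>X\<^sup>d\<close>, \<open>Y\<^sup>d\<close>, \<open>X Z\<^sup>d\<^sup>-\<^sup>1\<close> remain; the automorphism is then \<open>diag(1, u, w)\<close> with \<open>u\<close>, \<open>w\<close> of
  orders \<open>d\<close> and \<open>l\<close>, and invariance leaves exactly the monomials of \<open>C_tilde\<close>.

  For the automorphism group, consider the quadratic differential operators with constant
  coefficients that annihilate the equation of \<open>C_tilde\<close>: they are spanned by
  \<open>\<partial>\<^sub>X \<partial>\<^sub>Y\<close> and \<open>\<partial>\<^sub>Y \<partial>\<^sub>Z\<close>. A linear automorphism preserves this space, hence the common factor
  \<open>\<partial>\<^sub>Y\<close> and the span of \<open>\<partial>\<^sub>X\<close>, \<open>\<partial>\<^sub>Z\<close>, up to scalars.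
\<close>

section \<open>Derivatives and linear substitutions\<close>

text \<open>\<open>peval const var F\<close> rebuilds \<open>F\<close> from constants and variables
  by sums and products. This induction serves claims that respect products, such as the chain
  rule.\<close>

lemma poly3_induct [case_names const var add mult]:
  fixes F :: "'a::comm_semiring_1 poly3"
  assumes const: "\<And>c. P (const c)" and var: "\<And>i. P (var i)"
    and add: "\<And>F G. P F \<Longrightarrow> P G \<Longrightarrow> P (F + G)" and mult: "\<And>F G. P F \<Longrightarrow> P G \<Longrightarrow> P (F * G)"
  shows "P F"
proof -
  have zero: "P 0" and one: "P 1"
    using const[of 0] const[of 1] by simp_all
  have sum: "P (\<Sum>i\<in>I. f i)" if "\<And>i. P (f i)" for f :: "(3 \<Rightarrow>\<^sub>0 nat) \<Rightarrow> 'a poly3" and I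
    by (induction I rule: infinite_finite_induct) (auto intro: zero add that)
  have prod: "P (\<Prod>i\<in>I. f i)" if "\<And>i. P (f i)" for f :: "3 \<Rightarrow> 'a poly3" and I
    by (induction I rule: infinite_finite_induct) (auto intro: one mult that)
  have power: "P (G ^ n)" if "P G" for G n
    by (induction n) (auto intro: one mult that)
  have "P (peval const var F)"
    unfolding peval_def by (intro sum mult const prod power var)
  then show ?thesis
    by (simp add: peval_const_var)
qed

text \<open>The single terms of \<open>F\<close> add up to \<open>F\<close>. This induction serves
  claims that are additive in \<open>F\<close>, such as coefficient formulas.\<close>

lemma poly3_single_induct [case_names single add]:
  fixes F :: "'a::comm_semiring_1 poly3"
  assumes single: "\<And>m c. P (Poly_Mapping.single m c)" and add: "\<And>F G. P F \<Longrightarrow> P G \<Longrightarrow> P (F + G)"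
  shows "P F"
proof -
  have zero: "P 0"
    using single[of 0 0] by simp
  have "P (\<Sum>m\<in>I. Poly_Mapping.single m (Poly_Mapping.lookup F m))" for I
    by (induction I rule: infinite_finite_induct) (auto intro: zero single add)
  from this[of "Poly_Mapping.keys F"] show ?thesis
    by (subst const.poly3_as_sum)
qed

section \<open>Formal partial derivatives\<close>

lemma pderiv3_superset:
  assumes "finite S" "Poly_Mapping.keys F \<subseteq> S"
  shows "pderiv3 i F =
    (\<Sum>m\<in>S. Poly_Mapping.single (m - Poly_Mapping.single i 1)
      (of_nat (Poly_Mapping.lookup m i) * Poly_Mapping.lookup F m))"
  unfolding pderiv3_def
  by (rule sum.mono_neutral_left) (use assms in \<open>auto simp: not_in_keys_iff_lookup_eq_zero\<close>)

lemma pderiv3_0 [simp]: "pderiv3 i 0 = 0"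
  by (simp add: pderiv3_def)

lemma pderiv3_single:
  "pderiv3 i (Poly_Mapping.single m c) =
    Poly_Mapping.single (m - Poly_Mapping.single i 1) (of_nat (Poly_Mapping.lookup m i) * c)"
  by (subst pderiv3_superset[of "{m}"]) auto

lemma pderiv3_add [simp]: "pderiv3 i (F + G) = pderiv3 i F + pderiv3 i G"
proof -
  let ?S = "Poly_Mapping.keys F \<union> Poly_Mapping.keys G"
  have "Poly_Mapping.keys (F + G) \<subseteq> ?S"
    by (rule Poly_Mapping.keys_add)
  then show ?thesis
    by (simp add: pderiv3_superset[of ?S] lookup_add distrib_left single_add sum.distrib)
qed

lemma pderiv3_sum [simp]: "pderiv3 i (\<Sum>k\<in>I. f k) = (\<Sum>k\<in>I. pderiv3 i (f k))"
  by (induction I rule: infinite_finite_induct) auto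

lemma pderiv3_const [simp]: "pderiv3 i (const c) = 0"
  by (simp add: const_def pderiv3_single)

lemma pderiv3_var: "pderiv3 i (var j) = (if i = j then 1 else 0)"
  by (simp add: var_def pderiv3_single lookup_single when_def)

lemma minus_single_add:
  fixes m n :: "3 \<Rightarrow>\<^sub>0 nat"
  assumes "Poly_Mapping.lookup m i \<noteq> 0"
  shows "m + n - Poly_Mapping.single i 1 = (m - Poly_Mapping.single i 1) + n"
  by (rule poly_mapping_eqI) (use assms in \<open>auto simp: lookup_add lookup_minus lookup_single when_def\<close>)

lemma pderiv3_mult [simp]: "pderiv3 i (F * G) = pderiv3 i F * G + F * pderiv3 i G"
proof -
  let ?s = "\<lambda>m. Poly_Mapping.single m :: 'a \<Rightarrow> 'a poly3"
  \<comment> \<open>If variable \<open>i\<close> does not occur in \<open>m\<close>, truncated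
    subtraction breaks the exponent law, but then both coefficients are 0.\<close>
  have shift: "?s ((m - Poly_Mapping.single i 1) + n) (of_nat (Poly_Mapping.lookup m i) * c)
      = ?s (m + n - Poly_Mapping.single i 1) (of_nat (Poly_Mapping.lookup m i) * c)" for m n c
    by (cases "Poly_Mapping.lookup m i = 0") (simp_all add: minus_single_add del: One_nat_def)
  have single: "pderiv3 i (?s m a * ?s n b) = pderiv3 i (?s m a) * ?s n b + ?s m a * pderiv3 i (?s n b)"
    for m n a b
  proof -
    have "pderiv3 i (?s m a) * ?s n b =
        ?s (m + n - Poly_Mapping.single i 1) (of_nat (Poly_Mapping.lookup m i) * (a * b))"
      using shift[of m n "a * b"] by (simp add: pderiv3_single mult_single mult.assoc)
    moreover have "?s m a * pderiv3 i (?s n b) =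
        ?s (m + n - Poly_Mapping.single i 1) (of_nat (Poly_Mapping.lookup n i) * (a * b))"
      using shift[of n m "a * b"]
      by (simp add: pderiv3_single mult_single add.commute[of m] mult.left_commute)
    ultimately show ?thesis
      by (simp add: pderiv3_single mult_single lookup_add distrib_right single_add)
  qed
  have G: "pderiv3 i (?s m a * G) = pderiv3 i (?s m a) * G + ?s m a * pderiv3 i G" for m a
    by (induction G rule: poly3_single_induct) (simp_all only: single pderiv3_add distrib_left add_ac)
  show ?thesis
    by (induction F rule: poly3_single_induct) (simp_all only: G pderiv3_add distrib_right add_ac)
qed

text \<open>Lowering the exponent of variable \<open>i\<close> is injective on the monomials that
  contain it, and the others contribute 0. Shifting upwards on the right-hand side avoids truncated
  subtraction.\<close>

lemma lookup_pderiv3: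
  "Poly_Mapping.lookup (pderiv3 i F) m =
    of_nat (Poly_Mapping.lookup m i + 1) * Poly_Mapping.lookup F (m + Poly_Mapping.single i 1)"
proof -
  have single: "Poly_Mapping.lookup (pderiv3 i (Poly_Mapping.single n c)) m =
      of_nat (Poly_Mapping.lookup m i + 1) *
      Poly_Mapping.lookup (Poly_Mapping.single n c) (m + Poly_Mapping.single i 1)"
    for n and c :: 'a
  proof (cases "Poly_Mapping.lookup n i = 0")
    case True
    then have "n \<noteq> m + Poly_Mapping.single i 1"
      by (auto simp: lookup_add)
    with True show ?thesis
      by (simp add: pderiv3_single lookup_single)
  next
    case False
    have "n = (n - Poly_Mapping.single i 1) + Poly_Mapping.single i 1"
      by (rule poly_mapping_eqI)
        (use False in \<open>auto simp: lookup_add lookup_minus lookup_single when_def\<close>)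
    then have "n - Poly_Mapping.single i 1 = m \<longleftrightarrow> n = m + Poly_Mapping.single i 1"
      by (metis add_diff_cancel_right')
    then show ?thesis
      by (auto simp: pderiv3_single lookup_single when_def lookup_add)
  qed
  show ?thesis
    by (induction F rule: poly3_single_induct) (simp_all only: single pderiv3_add lookup_add distrib_left)
qed

lemma lin_subst_const [simp]: "lin_subst A (const c) = const c"
  and lin_subst_var: "lin_subst A (var i) = (\<Sum>j\<in>UNIV. const (A $ i $ j) * var j)"
  and lin_subst_0 [simp]: "lin_subst A 0 = 0"
  and lin_subst_1 [simp]: "lin_subst A 1 = 1"
  and lin_subst_add [simp]: "lin_subst A (F + G) = lin_subst A F + lin_subst A G"
  and lin_subst_mult [simp]: "lin_subst A (F * G) = lin_subst A F * lin_subst A G"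
  by (simp_all add: lin_subst_def)

text \<open>Chain rule: both sides are additive in \<open>F\<close> and obey the same product rule,
  so constants and variables suffice. The derivative of the \<open>k\<close>-th linear form by
  variable \<open>i\<close> is \<open>A $ k $ i\<close>.\<close>

lemma pderiv3_lin_subst:
  "pderiv3 i (lin_subst A F) = (\<Sum>k\<in>UNIV. const (A $ k $ i) * lin_subst A (pderiv3 k F))"
proof (induction F rule: poly3_induct)
  case (var j)
  have "pderiv3 i (lin_subst A (var j)) = const (A $ j $ i)"
    by (simp add: lin_subst_var pderiv3_var if_distrib[of "(*) x" for x] cong: if_cong)
  also have "\<dots> = (\<Sum>k\<in>UNIV. const (A $ k $ i) * lin_subst A (pderiv3 k (var j)))"
    by (simp add: pderiv3_var if_distrib[of "lin_subst A"] if_distrib[of "(*) x" for x] cong: if_cong)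
  finally show ?case .
next
  case (add F G)
  then show ?case
    by (simp add: distrib_left sum.distrib)
next
  case (mult F G)
  then show ?case
    by (simp only: lin_subst_mult pderiv3_mult lin_subst_add sum_distrib_left sum_distrib_right
        distrib_left sum.distrib) (simp only: mult_ac)
qed simp

lemma eval3_pderiv3_lin_subst:
  "eval3 (pderiv3 i (lin_subst A F)) v = (\<Sum>k\<in>UNIV. A $ k $ i * eval3 (pderiv3 k F) (A *v v))"
  by (simp add: pderiv3_lin_subst eval3_lin_subst)

section \<open>Homogeneous forms\<close>

lemma homogeneous3_0 [simp]: "homogeneous3 d 0"
  by (simp add: homogeneous3_def)

lemma homogeneous3_const: "homogeneous3 0 (const c)"
  by (simp add: homogeneous3_def const_def)

lemma homogeneous3_1: "homogeneous3 0 (1 :: 'a::comm_semiring_1 poly3)"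
  using homogeneous3_const[of "1::'a"] by simp

lemma homogeneous3_var: "homogeneous3 1 (var i)"
  by (simp add: homogeneous3_def var_def lookup_single when_def)

lemma homogeneous3_add: "homogeneous3 d F \<Longrightarrow> homogeneous3 d G \<Longrightarrow> homogeneous3 d (F + G)"
  unfolding homogeneous3_def using Poly_Mapping.keys_add[of F G] by blast

lemma homogeneous3_sum: "(\<And>i. i \<in> I \<Longrightarrow> homogeneous3 d (f i)) \<Longrightarrow> homogeneous3 d (\<Sum>i\<in>I. f i)"
  by (induction I rule: infinite_finite_induct) (auto intro: homogeneous3_add)

lemma homogeneous3_mult:
  fixes F G :: "'a::comm_semiring_1 poly3"
  assumes "homogeneous3 d F" "homogeneous3 e G"
  shows "homogeneous3 (d + e) (F * G)"
  unfolding homogeneous3_def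
proof
  fix m assume "m \<in> Poly_Mapping.keys (F * G)"
  then obtain a b where "m = a + b" "a \<in> Poly_Mapping.keys F" "b \<in> Poly_Mapping.keys G"
    using Poly_Mapping.keys_mult[of F G] by auto
  with assms show "(\<Sum>i\<in>UNIV. Poly_Mapping.lookup m i) = d + e"
    by (simp add: homogeneous3_def lookup_add sum.distrib)
qed

lemma homogeneous3_prod:
  fixes f :: "'b \<Rightarrow> 'a::comm_semiring_1 poly3"
  shows "(\<And>i. homogeneous3 (e i) (f i)) \<Longrightarrow> homogeneous3 (\<Sum>i\<in>I. e i) (\<Prod>i\<in>I. f i)"
  by (induction I rule: infinite_finite_induct) (auto intro: homogeneous3_1 homogeneous3_mult)

lemma homogeneous3_power:
  fixes F :: "'a::comm_semiring_1 poly3"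
  shows "homogeneous3 d F \<Longrightarrow> homogeneous3 (n * d) (F ^ n)"
  by (induction n) (auto intro: homogeneous3_1 homogeneous3_mult)

lemma homogeneous3_lin_subst:
  assumes "homogeneous3 d F"
  shows "homogeneous3 d (lin_subst A F)"
  unfolding lin_subst_def peval_def
proof (rule homogeneous3_sum)
  fix m assume "m \<in> Poly_Mapping.keys F"
  with assms have d: "d = 0 + (\<Sum>i\<in>UNIV. Poly_Mapping.lookup m i * 1)"
    by (simp add: homogeneous3_def)
  have lin: "homogeneous3 1 (\<Sum>j\<in>UNIV. const (A $ i $ j) * var j)" for i
    using homogeneous3_mult[OF homogeneous3_const homogeneous3_var] by (intro homogeneous3_sum) simp
  show "homogeneous3 d (const (Poly_Mapping.lookup F m) *
      (\<Prod>i\<in>UNIV. (\<Sum>j\<in>UNIV. const (A $ i $ j) * var j) ^ Poly_Mapping.lookup m i))"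
    unfolding d by (intro homogeneous3_mult homogeneous3_const homogeneous3_prod homogeneous3_power lin)
qed

lemma homogeneous3_pderiv3:
  assumes "homogeneous3 d F"
  shows "homogeneous3 (d - 1) (pderiv3 i F)"
  unfolding homogeneous3_def
proof
  fix m assume "m \<in> Poly_Mapping.keys (pderiv3 i F)"
  then have "m + Poly_Mapping.single i 1 \<in> Poly_Mapping.keys F"
    by (auto simp: in_keys_iff lookup_pderiv3)
  with assms have "(\<Sum>j\<in>UNIV. Poly_Mapping.lookup (m + Poly_Mapping.single i 1) j) = d"
    by (simp add: homogeneous3_def)
  then show "(\<Sum>j\<in>UNIV. Poly_Mapping.lookup m j) = d - 1"
    by (auto simp: lookup_add sum.distrib lookup_single when_def)
qed

text \<open>Every monomial of degree \<open>d\<close> other than the pure power contains a variable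
  that vanishes at the vertex. Values at vertices thus become coefficients.\<close>

lemma eval3_axis:
  assumes "homogeneous3 d F"
  shows "eval3 F (axis i 1) = Poly_Mapping.lookup F (Poly_Mapping.single i d)"
proof -
  have axis: "(axis i 1 :: 'a ^ 3) $ j = (if j = i then 1 else 0)" for j
    by (simp add: axis_def)
  have eq: "(\<Prod>j\<in>UNIV. (axis i 1 :: 'a ^ 3) $ j ^ Poly_Mapping.lookup m j) =
      (if m = Poly_Mapping.single i d then 1 else 0)" if m: "m \<in> Poly_Mapping.keys F" for m
  proof (cases "\<forall>j. j \<noteq> i \<longrightarrow> Poly_Mapping.lookup m j = 0")
    case True
    have "(\<Sum>j\<in>UNIV. Poly_Mapping.lookup m j) = (\<Sum>j\<in>{i}. Poly_Mapping.lookup m j)"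
      by (rule sum.mono_neutral_right) (use True in simp_all)
    with assms m have "Poly_Mapping.lookup m i = d"
      by (simp add: homogeneous3_def)
    with True have "m = Poly_Mapping.single i d"
      by (intro poly_mapping_eqI) (metis lookup_single_eq lookup_single_not_eq)
    moreover have "(\<Prod>j\<in>UNIV. (axis i 1 :: 'a ^ 3) $ j ^ Poly_Mapping.lookup m j) = 1"
    proof (rule prod.neutral, rule ballI)
      fix j
      show "(axis i 1 :: 'a ^ 3) $ j ^ Poly_Mapping.lookup m j = 1"
        using True by (cases "j = i") (simp_all add: axis)
    qed
    ultimately show ?thesis
      by simp
  next
    case False
    then obtain j where j: "j \<noteq> i" "Poly_Mapping.lookup m j \<noteq> 0"
      by blast
    then have "(axis i 1 :: 'a ^ 3) $ j ^ Poly_Mapping.lookup m j = 0"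
      by (simp add: axis power_0_left)
    then have "(\<Prod>j\<in>UNIV. (axis i 1 :: 'a ^ 3) $ j ^ Poly_Mapping.lookup m j) = 0"
      by (intro prod_zero) (simp, blast)
    moreover have "m \<noteq> Poly_Mapping.single i d"
      using j by (metis lookup_single_not_eq)
    ultimately show ?thesis
      by simp
  qed
  have "eval3 F (axis i 1) = (\<Sum>m\<in>Poly_Mapping.keys F.
      if m = Poly_Mapping.single i d then Poly_Mapping.lookup F m else 0)"
    unfolding peval_def by (rule sum.cong) (simp_all add: eq)
  then show ?thesis
    by (simp add: in_keys_iff)
qed

lemma lookup_const_mult: "Poly_Mapping.lookup (const c * F) m = c * Poly_Mapping.lookup F m"
proof -
  have "const c * F = Poly_Mapping.map ((*) c) F"
    unfolding const_def by (rule mult_map_scale_conv_mult[symmetric])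
  then show ?thesis
    by (simp add: map.rep_eq when_def)
qed

text \<open>Each monomial is an eigenvector of a diagonal substitution, so invariance can be tested
  coefficient by coefficient.\<close>

lemma lookup_lin_subst_diagonal:
  "Poly_Mapping.lookup (lin_subst (\<chi> i j. if i = j then e i else 0) F) n =
    (\<Prod>i\<in>UNIV. e i ^ Poly_Mapping.lookup n i) * Poly_Mapping.lookup F n"
proof (induction F rule: poly3_single_induct)
  case (single m c)
  have diag: "lin_subst (\<chi> i j. if i = j then e i else 0) G = peval const (\<lambda>i. const (e i) * var i) G" for G
    unfolding lin_subst_def
    by (intro arg_cong[of _ _ "\<lambda>x. peval const x G"] ext)
      (simp add: if_distrib[of const] if_distrib[of "\<lambda>x. x * y" for y] cong: if_cong)
  have pow: "const (a ^ k) = const a ^ k" for a :: 'a and k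
    by (induction k) simp_all
  have prod: "const (\<Prod>i\<in>I. f i) = (\<Prod>i\<in>I. const (f i))" for f :: "3 \<Rightarrow> 'a" and I
    by (induction I rule: infinite_finite_induct) simp_all
  have "lin_subst (\<chi> i j. if i = j then e i else 0) (Poly_Mapping.single m c) =
      const (\<Prod>i\<in>UNIV. e i ^ Poly_Mapping.lookup m i) * peval const var (Poly_Mapping.single m c)"
    unfolding diag const.peval_single
    by (simp only: power_mult_distrib prod.distrib pow prod mult_ac)
  then show ?case
    by (simp add: peval_const_var lookup_const_mult lookup_single when_def)
next
  case (add F G)
  then show ?case
    by (simp only: lin_subst_add lookup_add distrib_left)
qed

text \<open>The derivative of \<open>F\<close> at the point \<open>v\<close> in the direction
  \<open>w\<close>. At basis vectors it detects monomials of the equation in the corresponding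
  coordinates.\<close>

definition directional :: "'a::comm_semiring_1 poly3 \<Rightarrow> 'a ^ 3 \<Rightarrow> 'a ^ 3 \<Rightarrow> 'a"
  where "directional F v w = (\<Sum>r\<in>UNIV. w $ r * eval3 (pderiv3 r F) v)"

lemma eval3_scale:
  assumes "homogeneous3 d F"
  shows "eval3 F (t *s v) = t ^ d * eval3 F v"
proof -
  have "(\<Prod>i\<in>UNIV. (t *s v) $ i ^ Poly_Mapping.lookup m i) =
      t ^ d * (\<Prod>i\<in>UNIV. v $ i ^ Poly_Mapping.lookup m i)" if "m \<in> Poly_Mapping.keys F" for m
  proof -
    have "(\<Sum>i\<in>UNIV. Poly_Mapping.lookup m i) = d"
      using assms that by (simp add: homogeneous3_def)
    then show ?thesis
      by (simp add: power_mult_distrib prod.distrib power_sum[symmetric])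
  qed
  then show ?thesis
    unfolding peval_def sum_distrib_left
    by (intro sum.cong) (simp_all add: mult.left_commute)
qed

section \<open>Diagonalization of matrices of finite projective order\<close>

text \<open>The polynomial \<open>x ^ n - 1\<close> splits into linear factors and, in
  characteristic zero, shares no root with its derivative, so its roots are distinct.\<close>

lemma card_roots_of_unity:
  assumes "n > 0"
  shows "card {x :: 'a::{alg_closed_field, field_char_0}. x ^ n = 1} = n"
proof -
  define p :: "'a poly" where "p = Polynomial.monom 1 n - 1"
  have poly_p: "poly p x = x ^ n - 1" for x
    by (simp add: p_def poly_monom)
  have pderiv_p: "poly (pderiv p) x = of_nat n * x ^ (n - 1)" for x
    by (simp add: p_def pderiv_diff pderiv_monom poly_monom)
  have deg: "degree p = n"
  proof -
    have "degree p = degree (Polynomial.monom (1::'a) n)"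
      unfolding p_def diff_conv_add_uminus
      by (rule degree_add_eq_left) (use assms in \<open>simp add: degree_monom_eq\<close>)
    then show ?thesis
      by (simp add: degree_monom_eq)
  qed
  then have "p \<noteq> 0"
    using assms by auto
  then obtain A where A: "size A = degree p" "p = Polynomial.smult (lead_coeff p) (\<Prod>x\<in>#A. [:-x, 1:])"
    using alg_closed_imp_factorization by blast
  have roots: "poly p x = 0 \<longleftrightarrow> x \<in># A" for x
    using \<open>p \<noteq> 0\<close> by (subst A(2)) (auto simp: poly_prod_mset prod_mset_zero_iff image_iff)
  have "count A x \<le> 1" for x
  proof (rule ccontr)
    assume "\<not> count A x \<le> 1"
    then have "{#x, x#} \<subseteq># A"
      by (auto simp: subseteq_mset_def)
    then obtain B where B: "A = {#x, x#} + B"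
      by (metis subset_mset.add_diff_inverse)
    define q where "q = Polynomial.smult (lead_coeff p) (\<Prod>y\<in>#B. [:-y, 1:])"
    define f where "f y = [:-y, 1:]" for y :: 'a
    have p_eq: "p = f x * (f x * q)"
      using A(2) unfolding q_def B f_def[symmetric] by (simp add: mult.assoc)
    have "poly (pderiv p) x = 0"
      unfolding p_eq pderiv_mult poly_add poly_mult by (simp add: f_def)
    then have "x = 0"
      using assms by (simp add: pderiv_p)
    moreover have "x ^ n = 1"
      using roots[of x] by (simp add: B poly_p)
    ultimately show False
      using assms by (simp add: power_0_left)
  qed
  then have "count A x = 1" if "x \<in># A" for x
    using that by (simp add: le_antisym Suc_le_eq)
  then have "size A = card (set_mset A)"
    by (simp add: size_multiset_overloaded_eq)
  moreover have "set_mset A = {x. x ^ n = 1}"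
    using roots by (auto simp: poly_p)
  ultimately show ?thesis
    using A deg by simp
qed

text \<open>Multiplication by a root \<open>y\<close> permutes the roots but scales the sum by
  \<open>inverse (y ^ j)\<close>, which can be made different from 1.\<close>

lemma sum_power_roots_of_unity:
  assumes "0 < j" "j < n"
  shows "(\<Sum>x | x ^ n = 1. inverse x ^ j) = (0 :: 'a::{alg_closed_field, field_char_0})"
proof -
  let ?R = "{x :: 'a. x ^ n = 1}"
  \<comment> \<open>Only \<open>j < n\<close> elements satisfy \<open>x ^ j = 1\<close>, so some
    root of order dividing \<open>n\<close> does not.\<close>
  obtain y :: 'a where y: "y ^ n = 1" "y ^ j \<noteq> 1"
  proof (rule ccontr)
    assume "\<not> thesis"
    then have sub: "?R \<subseteq> {x. x ^ j = 1}"
      using that by blast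
    have "finite {x :: 'a. x ^ j = 1}"
      using card_roots_of_unity[OF assms(1), where 'a = 'a] assms(1)
      by (metis card.infinite less_irrefl)
    from card_mono[OF this sub] have "n \<le> j"
      using assms by (simp add: card_roots_of_unity)
    with assms show False
      by simp
  qed
  have y0: "y \<noteq> 0"
    using y assms by (auto simp: power_0_left)
  have "(\<Sum>x\<in>?R. inverse x ^ j) = (\<Sum>x\<in>?R. inverse (y * x) ^ j)"
    by (rule sum.reindex_bij_witness[of _ "\<lambda>x. y * x" "\<lambda>x. inverse y * x"])
      (use y y0 in \<open>auto simp: power_mult_distrib power_inverse\<close>)
  also have "\<dots> = inverse (y ^ j) * (\<Sum>x\<in>?R. inverse x ^ j)"
    by (simp add: sum_distrib_left power_mult_distrib power_inverse)
  finally show ?thesis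
    using y by auto
qed

text \<open>The eigencomponents of \<open>v\<close> are its averages over the powers of \<open>A\<close>, twisted by the
  characters of the cyclic group generated by \<open>A\<close>.\<close>

lemma span_eigenvectors:
  fixes A :: "'a::{alg_closed_field, field_char_0} ^ 'n ^ 'n"
  assumes "N > 0" "s \<noteq> 0" and pow: "\<And>v. ((*v) A ^^ N) v = s *s v"
  shows "vec.span {w. \<exists>t. A *v w = t *s w} = UNIV"
proof -
  let ?E = "{w. \<exists>t. A *v w = t *s w}"
  let ?R = "{x :: 'a. x ^ N = 1}"
  obtain r where r: "r ^ N = s"
    using nth_root_exists[OF \<open>N > 0\<close>] by blast
  have "v \<in> vec.span ?E" for v
  proof -
    define f where "f j = ((*v) A ^^ j) v" for j
    define w where "w t = (\<Sum>j<N. inverse t ^ j *s f j)" for t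
    have w_E: "w t \<in> ?E" if t: "t ^ N = s" for t
    proof -
      have t0: "t \<noteq> 0"
        using t assms by (auto simp: power_0_left)
      have shift: "A *v f j = f (Suc j)" for j
        by (simp add: f_def)
      \<comment> \<open>The index shift is cyclic: as \<open>t ^ N = s\<close>, the twisted term at
        \<open>N\<close> equals the term at 0.\<close>
      have "(\<Sum>j<Suc N. inverse t ^ j *s f j) = f 0 + (\<Sum>j<N. inverse t ^ Suc j *s f (Suc j))"
        by (subst sum.lessThan_Suc_shift) simp
      moreover have "inverse t ^ N *s f N = f 0"
        using t t0 \<open>s \<noteq> 0\<close> pow[of v] by (simp add: f_def power_inverse)
      ultimately have w: "w t = (\<Sum>j<N. inverse t ^ Suc j *s f (Suc j))"
        by (simp add: w_def add.commute)
      have "A *v w t = (\<Sum>j<N. inverse t ^ j *s f (Suc j))"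
        by (simp add: w_def vec.sum vec.scale shift)
      also have "\<dots> = t *s (\<Sum>j<N. inverse t ^ Suc j *s f (Suc j))"
        using t0 by (simp add: vec.scale_sum_right mult.assoc[symmetric])
      finally show ?thesis
        using w by auto
    qed
    \<comment> \<open>The possible eigenvalues are the \<open>N\<close>-th roots
      \<open>r * x\<close> of \<open>s\<close>. Summing over all of them cancels every power of
      \<open>A\<close> except the zeroth, which is counted \<open>N\<close> times.\<close>
    have "(\<Sum>x\<in>?R. w (r * x)) = (\<Sum>j<N. (\<Sum>x\<in>?R. inverse x ^ j) *s (inverse r ^ j *s f j))"
      unfolding w_def
      by (subst sum.swap) (simp add: vec.scale_sum_left power_mult_distrib sum_distrib_left mult.commute)
    also have "\<dots> = (\<Sum>j<N. if j = 0 then of_nat N *s v else 0)"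
      by (rule sum.cong) (use assms in \<open>auto simp: sum_power_roots_of_unity card_roots_of_unity f_def\<close>)
    also have "\<dots> = of_nat N *s v"
      using assms by simp
    finally have "v = inverse (of_nat N) *s (\<Sum>x\<in>?R. w (r * x))"
      using assms by simp
    moreover have "w (r * x) \<in> ?E" if "x \<in> ?R" for x
      using that r by (intro w_E) (simp add: power_mult_distrib)
    ultimately show ?thesis
      by (metis (no_types, lifting) vec.span_base vec.span_scale vec.span_sum)
  qed
  then show ?thesis
    by blast
qed

section \<open>Bases of eigenvectors\<close>

definition column_matrix :: "('n \<Rightarrow> 'a ^ 'm) \<Rightarrow> 'a ^ 'n ^ 'm"
  where "column_matrix b = (\<chi> i j. b j $ i)"

lemma column_matrix_nth [simp]: "column_matrix b $ i $ j = b j $ i"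
  by (simp add: column_matrix_def)

text \<open>A spanning set contains a basis, whose size is the dimension, so it can be indexed by
  the coordinate type and placed in the columns of a matrix.\<close>

lemma eigenbasis_exists:
  fixes A :: "'a::field ^ 'n ^ 'n"
  assumes "vec.span {w. \<exists>t. A *v w = t *s w} = UNIV"
  obtains b :: "'n \<Rightarrow> 'a ^ 'n" and e where "invertible (column_matrix b)" "\<And>j. A *v b j = e j *s b j"
proof -
  let ?E = "{w. \<exists>t. A *v w = t *s w}"
  obtain B where B: "B \<subseteq> ?E" "vec.independent B" "?E \<subseteq> vec.span B"
    using vec.maximal_independent_subset by blast
  have span: "vec.span B = UNIV"
    using vec.span_minimal[OF B(3) vec.subspace_span] assms by auto
  have fin: "finite B"
    using B(2) by (rule vec.finiteI_independent)
  have "card B = CARD('n)"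
    using vec.basis_card_eq_dim[of B UNIV] B(2) span by (simp add: card_cart_basis)
  then obtain b where b: "bij_betw b (UNIV :: 'n set) B"
    using fin finite_same_card_bij[of "UNIV :: 'n set" B] by auto
  let ?P = "column_matrix b"
  have "column j ?P = b j" for j
    by (simp add: column_def)
  then have "columns ?P = B"
    using b by (auto simp: columns_def bij_betw_def)
  then have "invertible ?P"
    using matrix_right_invertible_span_columns[of ?P] span by (simp add: invertible_right_inverse)
  moreover have "\<exists>t. A *v b j = t *s b j" for j
    using B(1) b by (auto simp: bij_betw_def)
  then obtain e where e: "\<And>j. A *v b j = e j *s b j"
    by metis
  ultimately show thesis
    using that by blast
qed

lemma column_matrix_axis: "column_matrix b *v axis j (1 :: 'a::semiring_1) = b j"
  by (simp add: matrix_vector_mult_def axis_def vec_eq_iff if_distrib[of "(*) x" for x] cong: if_cong)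

lemma column_matrix_vector_mult: "column_matrix b *v x = (\<Sum>j\<in>UNIV. x $ j *s b j)"
  for x :: "'a::comm_semiring_1 ^ 'n"
  by (simp add: matrix_mult_sum column_def)

lemma matrix_mult_column_matrix:
  "A ** column_matrix b = column_matrix (\<lambda>j. A *v b j)"
  by (simp add: matrix_matrix_mult_def matrix_vector_mult_def vec_eq_iff)

lemma column_matrix_mult_diagonal:
  fixes b :: "'n::finite \<Rightarrow> 'a::comm_semiring_1 ^ 'm"
  shows "column_matrix b ** (\<chi> i j. if i = j then e i else 0) = column_matrix (\<lambda>j. e j *s b j)"
  by (simp add: matrix_matrix_mult_def vec_eq_iff if_distrib[of "(*) x" for x] mult.commute cong: if_cong)

lemma invertible_column_matrix_iff:
  fixes b :: "'n::finite \<Rightarrow> 'a::field ^ 'n"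
  shows "invertible (column_matrix b) \<longleftrightarrow>
    (\<forall>x. (\<Sum>j\<in>UNIV. x j *s b j) = 0 \<longrightarrow> (\<forall>j. x j = 0))"
  using matrix_left_invertible_independent_columns[of "column_matrix b"]
  by (simp add: invertible_left_inverse column_def)

text \<open>A relation among the new vectors pulls back to one among the \<open>b k\<close>. This
  freedom puts chosen eigenvectors in prescribed positions and normalises coefficients.\<close>

lemma invertible_column_matrix_reindex:
  fixes b :: "'n::finite \<Rightarrow> 'a::field ^ 'n"
  assumes inv: "invertible (column_matrix b)" and \<pi>: "bij (\<pi> :: 'n \<Rightarrow> 'n)" and s: "\<And>j. s j \<noteq> 0"
  shows "invertible (column_matrix (\<lambda>j. s j *s b (\<pi> j)))"
proof -
  define \<rho> where "\<rho> = inv_into UNIV \<pi>"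
  have \<rho>: "\<rho> (\<pi> j) = j" "\<pi> (\<rho> j) = j" for j
    using \<pi> by (simp_all add: \<rho>_def bij_is_inj bij_is_surj surj_f_inv_f)
  have "x j = 0" if "(\<Sum>j\<in>UNIV. x j *s (s j *s b (\<pi> j))) = 0" for x j
  proof -
    have "(\<Sum>j\<in>UNIV. x j *s (s j *s b (\<pi> j))) = (\<Sum>k\<in>UNIV. (x (\<rho> k) * s (\<rho> k)) *s b k)"
      by (intro sum.reindex_bij_witness[of _ \<rho> \<pi>]) (simp_all add: \<rho>)
    then have "(\<Sum>k\<in>UNIV. (x (\<rho> k) * s (\<rho> k)) *s b k) = 0"
      using that by simp
    note inv[unfolded invertible_column_matrix_iff, rule_format, OF this]
    then have "x (\<rho> (\<pi> j)) * s (\<rho> (\<pi> j)) = 0"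
      by blast
    then show "x j = 0"
      using s by (simp add: \<rho>)
  qed
  then show ?thesis
    unfolding invertible_column_matrix_iff by blast
qed

lemma funpow_eigenvectors:
  fixes A :: "'a::field ^ 'n ^ 'n"
  assumes "\<And>j. A *v b j = e j *s b j"
  shows "((*v) A ^^ M) (\<Sum>j\<in>J. x j *s b j) = (\<Sum>j\<in>J. (x j * e j ^ M) *s b j)"
  by (induction M) (simp_all add: vec.sum vec.scale assms mult_ac)

section \<open>The equation in eigenvector coordinates\<close>

lemma lookup_lin_subst_column_matrix:
  assumes "homogeneous3 d F"
  shows "Poly_Mapping.lookup (lin_subst (column_matrix b) F) (Poly_Mapping.single i d) = eval3 F (b i)"
proof -
  have "eval3 (lin_subst (column_matrix b) F) (axis i 1) =
      Poly_Mapping.lookup (lin_subst (column_matrix b) F) (Poly_Mapping.single i d)"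
    by (intro eval3_axis homogeneous3_lin_subst assms)
  then show ?thesis
    by (simp add: eval3_lin_subst column_matrix_axis)
qed

text \<open>In the new coordinates \<open>b i\<close> is the vertex \<open>axis i 1\<close>, where
  \<open>eval3_axis\<close> turns the derivative by variable \<open>k\<close> into a coefficient.
  For positive \<open>d\<close> the numerical factor is \<open>d\<close> if \<open>k = i\<close> and
  1 otherwise.\<close>

lemma lookup_lin_subst_column_matrix_add:
  assumes "homogeneous3 d F"
  shows "of_nat (Poly_Mapping.lookup (Poly_Mapping.single i (d - 1)) k + 1) *
      Poly_Mapping.lookup (lin_subst (column_matrix b) F) (Poly_Mapping.single i (d - 1) + Poly_Mapping.single k 1) =
    directional F (b i) (b k)"
proof -
  have "directional F (b i) (b k) = eval3 (pderiv3 k (lin_subst (column_matrix b) F)) (axis i 1)"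
    by (simp add: directional_def eval3_pderiv3_lin_subst column_matrix_axis)
  also have "\<dots> = Poly_Mapping.lookup (pderiv3 k (lin_subst (column_matrix b) F)) (Poly_Mapping.single i (d - 1))"
    by (intro eval3_axis homogeneous3_pderiv3 homogeneous3_lin_subst assms)
  finally show ?thesis
    by (simp only: lookup_pderiv3)
qed

text \<open>Otherwise \<open>b i\<close> is on the curve and the gradient there annihilates every
  \<open>b k\<close>; for \<open>k = i\<close> this follows from the absence of the pure power. The
  gradient is then zero and \<open>b i\<close> is a singular point.\<close>

lemma nonsingular_column_matrix:
  fixes b :: "3 \<Rightarrow> 'a::field ^ 3"
  assumes ns: "nonsingular_plane_curve d F" and d: "0 < d" and inv: "invertible (column_matrix b)"
  shows "eval3 F (b i) \<noteq> 0 \<or> (\<exists>k. k \<noteq> i \<and> directional F (b i) (b k) \<noteq> 0)"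
proof (rule ccontr)
  assume "\<not> ?thesis"
  then have F0: "eval3 F (b i) = 0" and dir: "\<And>k. k \<noteq> i \<Longrightarrow> directional F (b i) (b k) = 0"
    by auto
  have hom: "homogeneous3 d F"
    using ns by (simp add: nonsingular_plane_curve_def)
  have "Poly_Mapping.single i (d - 1) + Poly_Mapping.single i 1 = Poly_Mapping.single i d"
    using d by (simp flip: single_add)
  then have "directional F (b i) (b i) = 0"
    using lookup_lin_subst_column_matrix_add[OF hom, of i i b] lookup_lin_subst_column_matrix[OF hom, of b i] F0
    by (simp only: mult_zero_right)
  with dir have "directional F (b i) (b k) = 0" for k
    by (cases "k = i") auto
  then have "transpose (column_matrix b) *v (\<chi> r. eval3 (pderiv3 r F) (b i)) = 0"
    by (simp add: directional_def matrix_vector_mult_def transpose_def vec_eq_iff)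
  moreover have "invertible (transpose (column_matrix b))"
    using inv by (simp add: invertible_det_nz)
  ultimately have "(\<chi> r. eval3 (pderiv3 r F) (b i)) = 0"
    by (simp add: invertible_left_inverse matrix_left_invertible_ker)
  then have "eval3 (pderiv3 r F) (b i) = 0" for r
    by (simp add: vec_eq_iff)
  moreover have "b i \<noteq> 0"
  proof
    assume "b i = 0"
    then have "(\<Sum>j\<in>UNIV. (if j = i then 1 else 0) *s b j) = 0"
      by (intro sum.neutral) auto
    then show False
      using inv[unfolded invertible_column_matrix_iff, rule_format, of "\<lambda>j. if j = i then 1 else 0" i] by simp
  qed
  ultimately show False
    using ns F0 by (auto simp: nonsingular_plane_curve_def)
qed

text \<open>With \<open>P = column_matrix b\<close> and \<open>D\<close> the diagonal matrix of the
  eigenvalues, \<open>A ** P = P ** D\<close>. Hence \<open>lin_subst P F\<close> is multiplied by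
  \<open>c\<close> under \<open>D\<close>, and so is each of its monomials.\<close>

lemma lin_subst_eigenbasis:
  fixes b :: "3 \<Rightarrow> 'a::field ^ 3"
  assumes c: "lin_subst A F = const c * F" and b: "\<And>j. A *v b j = e j *s b j"
    and m: "Poly_Mapping.lookup (lin_subst (column_matrix b) F) m \<noteq> 0"
  shows "(\<Prod>i\<in>UNIV. e i ^ Poly_Mapping.lookup m i) = c"
proof -
  let ?G = "lin_subst (column_matrix b) F"
  have "lin_subst (\<chi> i j. if i = j then e i else 0) ?G = lin_subst (column_matrix b) (lin_subst A F)"
    unfolding lin_subst_lin_subst column_matrix_mult_diagonal matrix_mult_column_matrix b ..
  also have "\<dots> = const c * ?G"
    by (simp only: c lin_subst_const_mult)
  finally have "Poly_Mapping.lookup (lin_subst (\<chi> i j. if i = j then e i else 0) ?G) m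
      = Poly_Mapping.lookup (const c * ?G) m"
    by (rule arg_cong)
  then have "(\<Prod>i\<in>UNIV. e i ^ Poly_Mapping.lookup m i) * Poly_Mapping.lookup ?G m
      = c * Poly_Mapping.lookup ?G m"
    by (simp only: lookup_lin_subst_diagonal lookup_const_mult)
  with m show ?thesis
    by simp
qed

lemma prod_power_single: "(\<Prod>j\<in>UNIV. e j ^ Poly_Mapping.lookup (Poly_Mapping.single i n) j) = e i ^ n"
  for e :: "3 \<Rightarrow> 'a::comm_semiring_1"
proof -
  have "(\<Prod>j\<in>UNIV. e j ^ Poly_Mapping.lookup (Poly_Mapping.single i n) j) = (\<Prod>j\<in>UNIV. if j = i then e i ^ n else 1)"
    by (intro prod.cong) (auto simp: lookup_single when_def)
  then show ?thesis
    by simp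
qed

lemma eigenvalue_relations:
  fixes b :: "3 \<Rightarrow> 'a::field_char_0 ^ 3"
  assumes hom: "homogeneous3 d F" and c: "lin_subst A F = const c * F" and b: "\<And>j. A *v b j = e j *s b j"
  shows "eval3 F (b i) \<noteq> 0 \<Longrightarrow> e i ^ d = c"
    and "directional F (b i) (b k) \<noteq> 0 \<Longrightarrow> e i ^ (d - 1) * e k = c"
proof -
  show "e i ^ d = c" if "eval3 F (b i) \<noteq> 0"
    using lin_subst_eigenbasis[where b = b and e = e, OF c b, where m = "Poly_Mapping.single i d"] that
      lookup_lin_subst_column_matrix[OF hom, of b i] by (simp add: prod_power_single)
  show "e i ^ (d - 1) * e k = c" if "directional F (b i) (b k) \<noteq> 0"
  proof -
    have "Poly_Mapping.lookup (lin_subst (column_matrix b) F)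
        (Poly_Mapping.single i (d - 1) + Poly_Mapping.single k 1) \<noteq> 0"
      using that lookup_lin_subst_column_matrix_add[OF hom, of i k b] by (metis mult_zero_right)
    from lin_subst_eigenbasis[where b = b and e = e, OF c b this] show ?thesis
      by (simp add: lookup_add power_add prod.distrib prod_power_single del: One_nat_def)
  qed
qed

section \<open>Diagonal automorphisms of smooth curves\<close>

text \<open>Each pair of equations comes from a choice of monomials at the three vertices for
  \<open>diag(1, u, w)\<close>. It makes both ratios trivial at the exponent \<open>d\<close>,
  \<open>d - 1\<close>, \<open>d * (d - 2)\<close>, \<open>(d - 1)^2\<close>,
  \<open>d * (d - 3) + 3\<close> or \<open>(d - 1) * (d - 2)\<close> respectively, and none of these
  is divisible by \<open>l * d\<close>.\<close>

lemma diagonal_order_contradictions: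
  fixes u w :: "'a::field"
  assumes d: "5 \<le> d" and l: "3 \<le> l" "l dvd d - 1"
    and ord: "\<And>M. u ^ M = 1 \<Longrightarrow> w ^ M = 1 \<Longrightarrow> l * d dvd M"
    and nz: "u \<noteq> 0" "w \<noteq> 0"
  shows "\<lbrakk>u ^ d = 1; w ^ d = 1\<rbrakk> \<Longrightarrow> False"
    and "\<lbrakk>u ^ (d - 1) = 1; w ^ (d - 1) = 1\<rbrakk> \<Longrightarrow> False"
    and "\<lbrakk>u ^ (d - 1) * w = 1; w ^ (d - 1) * u = 1\<rbrakk> \<Longrightarrow> False"
    and "\<lbrakk>u ^ (d - 1) = 1; w ^ (d - 1) * u = 1\<rbrakk> \<Longrightarrow> False"
    and "\<lbrakk>u = u ^ (d - 1) * w; u = w ^ (d - 1)\<rbrakk> \<Longrightarrow> False"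
    and "\<lbrakk>u = u ^ (d - 1); u = w ^ (d - 1)\<rbrakk> \<Longrightarrow> False"
proof -
  obtain m where dm: "d = m + 2"
    using that[of "d - 2"] d by simp
  have m1: "d - 1 = Suc m" and m3: "3 \<le> m" and lm: "l dvd Suc m"
    using d l by (simp_all add: dm)
  have d_dvd: "d dvd M" if "u ^ M = 1" "w ^ M = 1" for M
    using ord[OF that] by (metis dvd_mult_right)
  have not_dvd: "\<not> d dvd M" if "0 < M" "M < d" for M
    using that by (auto dest: dvd_imp_le)
  show False if "u ^ d = 1" "w ^ d = 1"
    using ord[OF that] d l by (auto dest!: dvd_imp_le)
  show False if "u ^ (d - 1) = 1" "w ^ (d - 1) = 1"
    using d_dvd[OF that] d not_dvd[of "d - 1"] by simp
  show False if uw: "u ^ (d - 1) * w = 1" "w ^ (d - 1) * u = 1"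
  proof -
    \<comment> \<open>Eliminating \<open>y\<close> gives \<open>x ^ ((d - 1)^2) = x\<close>, and
      \<open>(d - 1)^2 - 1 = d * m\<close>. The hypotheses are symmetric, so this applies to
      \<open>u\<close> and to \<open>w\<close>.\<close>
    have *: "x ^ (d * m) = 1" if "x ^ Suc m * y = 1" "y ^ Suc m * x = 1" for x y :: 'a
    proof -
      have nz: "x \<noteq> 0" "y \<noteq> 0"
        using that by auto
      have "x ^ (Suc m * Suc m) * y ^ Suc m = (x ^ Suc m * y) ^ Suc m"
        by (simp only: power_mult power_mult_distrib)
      also have "\<dots> = y ^ Suc m * x"
        by (simp only: that power_one)
      finally have "x ^ (Suc m * Suc m) = x"
        using nz by (simp add: mult.commute del: power_Suc mult_Suc mult_Suc_right)
      moreover have "Suc m * Suc m = Suc (d * m)"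
        by (simp add: dm)
      ultimately show ?thesis
        using nz by simp
    qed
    have "l * d dvd d * m"
      using uw m1 by (intro ord *) auto
    then have "l dvd m"
      using d by (simp add: mult.commute)
    with lm have "l dvd 1"
      by (metis dvd_add_right_iff plus_1_eq_Suc add.commute)
    with l show False
      by simp
  qed
  show False if "u ^ (d - 1) = 1" "w ^ (d - 1) * u = 1"
  proof -
    have "w ^ ((d - 1) * (d - 1)) = (w ^ (d - 1) * u) ^ (d - 1)"
      using that(1) by (simp add: power_mult power_mult_distrib)
    then have "d dvd (d - 1) * (d - 1)"
      using that by (intro d_dvd) (simp_all add: power_mult)
    moreover have "(d - 1) * (d - 1) = d * m + 1"
      by (simp add: dm)
    ultimately have "d dvd 1"
      by (metis dvd_add_right_iff dvd_triv_left)
    with d show False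
      by simp
  qed
  show False if u: "u = u ^ (d - 1) * w" "u = w ^ (d - 1)"
  proof -
    have "w ^ Suc m = (w ^ Suc m) ^ Suc m * w"
      using u unfolding m1 by metis
    then have "w ^ Suc m * 1 = w ^ (Suc m * Suc m) * w"
      by (simp only: power_mult mult_1_right)
    \<comment> \<open>Rests on \<open>(d - 1)^2 + 1 = (d - 1) + d * (d - 3) + 3\<close>, with
      \<open>m - 1 = d - 3\<close>.\<close>
    moreover have "w ^ (Suc m * Suc m) * w = w ^ Suc m * w ^ (d * (m - 1) + 3)"
      using m3 by (simp add: dm power_add[symmetric] algebra_simps flip: power_Suc power_Suc2)
    ultimately have w: "w ^ (d * (m - 1) + 3) = 1"
      using nz by simp
    have "u ^ (d * (m - 1) + 3) = 1"
      by (subst u(2)) (metis w power_mult power_one mult.commute)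
    then have "d dvd d * (m - 1) + 3"
      using w by (rule d_dvd)
    then have "d dvd 3"
      by (metis dvd_add_right_iff dvd_triv_left)
    with not_dvd[of 3] d show False
      by simp
  qed
  show False if u: "u = u ^ (d - 1)" "u = w ^ (d - 1)"
  proof -
    have "u ^ m = 1"
      using u(1) nz unfolding m1 by simp
    then have "u ^ (Suc m * m) = 1" "w ^ (Suc m * m) = 1"
      using u(2) by (simp_all only: m1 power_mult) (metis power_mult power_one mult.commute)
    then have "d dvd Suc m * m"
      by (rule d_dvd)
    moreover have "Suc m * m = d * (m - 1) + 2"
      using m3 by (cases m) (simp_all add: dm)
    ultimately have "d dvd 2"
      by (metis dvd_add_right_iff dvd_triv_left)
    with not_dvd[of 2] d show False
      by simp
  qed
qed

text \<open>Raising the relation to the power \<open>d - 1\<close> removes \<open>w\<close>, and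
  \<open>d\<close> is coprime to \<open>d - 1\<close>. This gives \<open>u ^ j = 1\<close>, hence
  \<open>w ^ k = 1\<close>, and then the exponent \<open>k * d\<close> trivialises both.\<close>

lemma diagonal_exponents_dvd:
  fixes u w :: "'a::field"
  assumes l: "0 < l" "l dvd d - 1" and d: "1 < d"
    and ord: "\<And>M. u ^ M = 1 \<Longrightarrow> w ^ M = 1 \<Longrightarrow> l * d dvd M"
    and uw: "u ^ d = 1" "w ^ (d - 1) = 1" and eq: "u ^ j * w ^ k = 1"
  shows "d dvd j" "l dvd k"
proof -
  have "(u ^ j * w ^ k) ^ (d - 1) = u ^ (j * (d - 1)) * (w ^ (d - 1)) ^ k"
    by (simp add: power_mult_distrib power_mult[symmetric] mult.commute)
  then have *: "u ^ (j * (d - 1)) = 1"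
    using eq uw by simp
  have "l * d dvd j * (d - 1)"
  proof (rule ord[OF *])
    show "w ^ (j * (d - 1)) = 1"
      by (metis uw(2) power_mult power_one mult.commute)
  qed
  then have "d dvd j * (d - 1)"
    by (metis dvd_mult_right)
  moreover have "coprime d (d - 1)"
    using d coprime_diff_one_left_nat[of d] by (simp add: coprime_commute)
  ultimately show "d dvd j"
    by (simp add: coprime_dvd_mult_left_iff)
  then have "u ^ j = 1"
    using uw by (auto simp: power_mult elim!: dvdE)
  with eq have "w ^ k = 1"
    by simp
  have "l * d dvd k * d"
  proof (rule ord)
    show "u ^ (k * d) = 1"
      by (metis uw(1) power_mult power_one mult.commute)
    show "w ^ (k * d) = 1"
      using \<open>w ^ k = 1\<close> by (simp add: power_mult)
  qed
  then show "l dvd k"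
    using d by simp
qed

text \<open>Here \<open>off i\<close> says that the \<open>i\<close>-th coordinate vertex is not on the curve, and \<open>tgt i k\<close> that
  \<open>X\<^sub>i\<^sup>d\<^sup>-\<^sup>1 X\<^sub>k\<close> occurs in its equation.\<close>

lemma vertex_configuration:
  fixes e :: "3 \<Rightarrow> 'a::field" and c :: 'a
  assumes d: "5 \<le> d" and l: "3 \<le> l" "l dvd d - 1" and nz: "\<And>i. e i \<noteq> 0"
    and ord: "\<And>M t. (\<And>i. e i ^ M = t) \<Longrightarrow> l * d dvd M"
    and off: "\<And>i. off i \<Longrightarrow> e i ^ d = c"
    and tgt: "\<And>i k. tgt i k \<Longrightarrow> e i ^ (d - 1) * e k = c"
    and all: "\<And>i. off i \<or> (\<exists>k. k \<noteq> i \<and> tgt i k)"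
  obtains x y z where "x \<noteq> y" "y \<noteq> z" "x \<noteq> z" "off x" "off y" "tgt z x"
proof (rule ccontr)
  note result = that
  assume contr: "\<not> thesis"
  \<comment> \<open>Choose one available monomial per vertex. Exactly two pure powers give the
    desired configuration; three, one or none leave, up to permutation, these six patterns.\<close>
  have False if dist: "x \<noteq> y" "y \<noteq> z" "x \<noteq> z" and conf:
    "off x \<and> off y \<and> off z \<or> off x \<and> tgt y x \<and> tgt z x \<or> off x \<and> tgt y z \<and> tgt z y \<or>
     off x \<and> tgt y x \<and> tgt z y \<or> tgt x y \<and> tgt y z \<and> tgt z x \<or> tgt x y \<and> tgt y x \<and> tgt z x" for x y z
  proof -
    \<comment> \<open>All relations are homogeneous of degree \<open>d\<close> in the eigenvalues,
      so division by \<open>e x\<close> normalises the first one to 1.\<close>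
    define u w c' where "u = e y / e x" and "w = e z / e x" and "c' = c / e x ^ d"
    have dd: "e x ^ d = e x ^ (d - 1) * e x"
      using d by (metis One_nat_def Suc_pred mult.commute not_numeral_le_zero not_gr_zero power_Suc)
    have eq_ord: "l * d dvd M" if "u ^ M = 1" "w ^ M = 1" for M
    proof (rule ord[of M "e x ^ M"])
      fix i
      have "i = x \<or> i = y \<or> i = z"
        using dist exhaust_3[of i] exhaust_3[of x] exhaust_3[of y] exhaust_3[of z] by metis
      then show "e i ^ M = e x ^ M"
        using that nz by (auto simp: u_def w_def power_divide)
    qed
    have tgt': "(e i / e x) ^ (d - 1) * (e k / e x) = c'" if "tgt i k" for i k
      using tgt[OF that] nz by (simp add: c'_def dd power_divide)
    have off': "(e i / e x) ^ d = c'" if "off i" for i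
      using off[OF that] by (simp add: c'_def power_divide)
    have nz': "u \<noteq> 0" "w \<noteq> 0"
      using nz by (auto simp: u_def w_def)
    note contra = diagonal_order_contradictions[OF d l eq_ord nz']
    consider "off x" "off y" "off z" | "off x" "tgt y x" "tgt z x" | "off x" "tgt y z" "tgt z y"
      | "off x" "tgt y x" "tgt z y" | "tgt x y" "tgt y z" "tgt z x" | "tgt x y" "tgt y x" "tgt z x"
      using conf by blast
    then show False
    proof cases
      case 1
      then show False using contra(1) off'[of x] off'[of y] off'[of z]
        by (simp add: nz flip: u_def w_def)
    next
      case 2
      then show False using contra(2) off'[of x] tgt'[of y x] tgt'[of z x]
        by (simp add: nz flip: u_def w_def)
    next
      case 3
      then show False using contra(3) off'[of x] tgt'[of y z] tgt'[of z y]
        by (simp add: nz flip: u_def w_def)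
    next
      case 4
      then show False using contra(4) off'[of x] tgt'[of y x] tgt'[of z y]
        by (simp add: nz flip: u_def w_def)
    next
      case 5
      then show False using contra(5) tgt'[of x y] tgt'[of y z] tgt'[of z x]
        by (simp add: nz flip: u_def w_def)
    next
      case 6
      then show False using contra(6) tgt'[of x y] tgt'[of y x] tgt'[of z x]
        by (simp add: nz flip: u_def w_def)
    qed
  qed
  note no = this
  have no': False if "x \<noteq> y" "y \<noteq> z" "x \<noteq> z" "off x" "off y" "tgt z x" for x y z
    using contr result[OF that] by blast
  have "off 1 \<or> tgt 1 2 \<or> tgt 1 3" "off 2 \<or> tgt 2 1 \<or> tgt 2 3" "off 3 \<or> tgt 3 1 \<or> tgt 3 2"
    using all[of 1] all[of 2] all[of 3] by (metis exhaust_3)+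
  then show False
    using no[of 1 2 3] no[of 1 3 2] no[of 2 1 3] no[of 2 3 1] no[of 3 1 2] no[of 3 2 1]
      no'[of 1 2 3] no'[of 1 3 2] no'[of 2 1 3] no'[of 2 3 1] no'[of 3 1 2] no'[of 3 2 1]
    by (simp, argo)
qed

section \<open>The curve \<open>C_tilde\<close> and its automorphisms\<close>

definition mon3 :: "nat \<Rightarrow> nat \<Rightarrow> nat \<Rightarrow> 3 \<Rightarrow>\<^sub>0 nat"
  where "mon3 i j k = Poly_Mapping.single 1 i + Poly_Mapping.single 2 j + Poly_Mapping.single 3 k"

lemma lookup_mon3 [simp]:
  "Poly_Mapping.lookup (mon3 i j k) 1 = i"
  "Poly_Mapping.lookup (mon3 i j k) 2 = j"
  "Poly_Mapping.lookup (mon3 i j k) 3 = k"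
  by (simp_all add: mon3_def lookup_add lookup_single when_def)

lemma mon3_eq_iff [simp]: "mon3 i j k = mon3 i' j' k' \<longleftrightarrow> i = i' \<and> j = j' \<and> k = k'"
  by (metis lookup_mon3)

lemma mon3_cases:
  obtains i j k where "m = mon3 i j k"
proof
  show "m = mon3 (Poly_Mapping.lookup m 1) (Poly_Mapping.lookup m 2) (Poly_Mapping.lookup m 3)"
    by (rule poly_mapping_eqI) (metis exhaust_3 lookup_mon3)
qed

lemma single_eq_mon3:
  "Poly_Mapping.single 1 i = mon3 i 0 0" "Poly_Mapping.single 2 j = mon3 0 j 0"
  "Poly_Mapping.single 3 k = mon3 0 0 k"
  by (simp_all add: mon3_def)

lemma mon3_add: "mon3 i j k + mon3 i' j' k' = mon3 (i + i') (j + j') (k + k')"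
  by (simp add: mon3_def single_add add_ac)

lemma lookup_pderiv3_mon3:
  "Poly_Mapping.lookup (pderiv3 1 F) (mon3 i j k) = of_nat (Suc i) * Poly_Mapping.lookup F (mon3 (Suc i) j k)"
  "Poly_Mapping.lookup (pderiv3 2 F) (mon3 i j k) = of_nat (Suc j) * Poly_Mapping.lookup F (mon3 i (Suc j) k)"
  "Poly_Mapping.lookup (pderiv3 3 F) (mon3 i j k) = of_nat (Suc k) * Poly_Mapping.lookup F (mon3 i j (Suc k))"
  by (simp_all only: lookup_pderiv3 single_eq_mon3 mon3_add lookup_mon3 Suc_eq_plus1 add_0_right)

lemma lookup_C_tilde:
  "Poly_Mapping.lookup (C_tilde d l \<alpha> \<beta>) (mon3 i j k) =
    (if i = d \<and> j = 0 \<and> k = 0 then 1 else 0) + (if i = 0 \<and> j = d \<and> k = 0 then 1 else 0)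
    + (if i = 1 \<and> j = 0 \<and> k = d - 1 then \<alpha> else 0)
    + (if i = d - k \<and> j = 0 \<and> 2 \<le> k \<and> k \<le> d - 2 \<and> l dvd k then \<beta> k else 0)"
proof -
  let ?S = "{j. 2 \<le> j \<and> j \<le> d - 2 \<and> l dvd j}"
  have fin: "finite ?S"
    by (rule finite_subset[of _ "{..d}"]) auto
  have mono: "const c * var 1 ^ p * var 3 ^ q = Poly_Mapping.single (mon3 p 0 q) c" for c :: 'a and p q
    unfolding var_power by (simp add: const_def mult_single single_eq_mon3 mon3_add)
  have mono1: "const c * var 1 * var 3 ^ q = Poly_Mapping.single (mon3 1 0 q) c" for c :: 'a and q
    using mono[of c 1 q] by simp
  have "(\<Sum>q\<in>?S. Poly_Mapping.lookup (Poly_Mapping.single (mon3 (d - q) 0 q) (\<beta> q)) (mon3 i j k))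
      = (\<Sum>q\<in>?S. if q = k then (if i = d - k \<and> j = 0 then \<beta> k else 0) else 0)"
    by (rule sum.cong) (auto simp: lookup_single when_def)
  also have "\<dots> = (if i = d - k \<and> j = 0 \<and> k \<in> ?S then \<beta> k else 0)"
    using fin by (simp add: sum.delta)
  finally have sum: "Poly_Mapping.lookup (\<Sum>q\<in>?S. Poly_Mapping.single (mon3 (d - q) 0 q) (\<beta> q)) (mon3 i j k)
      = (if i = d - k \<and> j = 0 \<and> k \<in> ?S then \<beta> k else 0)"
    by (simp only: lookup_sum)
  have single: "Poly_Mapping.lookup (Poly_Mapping.single (mon3 i' j' k') c) (mon3 i j k) =
      (if i = i' \<and> j = j' \<and> k = k' then c else 0)" for i' j' k' and c :: 'a
    by (auto simp: lookup_single when_def)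
  show ?thesis
    unfolding C_tilde_def mono mono1 unfolding var_power single_eq_mon3 lookup_add sum single
    by simp
qed

text \<open>The variable \<open>Y\<close> occurs in the equation only as a pure power.\<close>

lemma pderiv3_pderiv3_C_tilde:
  assumes "2 \<le> d" "i = 1 \<or> i = 3"
  shows "pderiv3 i (pderiv3 2 (C_tilde d l \<alpha> \<beta>)) = 0"
proof (rule poly_mapping_eqI)
  fix m
  obtain p q r where m: "m = mon3 p q r"
    by (rule mon3_cases)
  show "Poly_Mapping.lookup (pderiv3 i (pderiv3 2 (C_tilde d l \<alpha> \<beta>))) m = Poly_Mapping.lookup 0 m"
    using assms by (auto simp: m lookup_pderiv3_mon3 lookup_C_tilde)
qed

lemma lin_subst_sum: "lin_subst A (\<Sum>i\<in>I. f i) = (\<Sum>i\<in>I. lin_subst A (f i))"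
  by (simp add: lin_subst_def)

lemma lin_subst_eq_0_iff:
  assumes "invertible A"
  shows "lin_subst A F = 0 \<longleftrightarrow> F = 0"
proof
  obtain B where B: "A ** B = mat 1"
    using assms by (auto simp: invertible_def)
  assume "lin_subst A F = 0"
  then have "lin_subst B (lin_subst A F) = 0"
    by simp
  then show "F = 0"
    by (simp add: lin_subst_lin_subst B lin_subst_mat1)
qed simp

text \<open>By the chain rule, the vanishing mixed derivatives of the substituted form become
  quadratic operators that annihilate the equation. Their coefficients are products of entries of
  column 2 with entries of column 1 or 3.\<close>

lemma linear_automorphism_C_tilde:
  fixes A :: "'a::field_char_0 ^ 3 ^ 3"
  assumes d: "5 \<le> d" and l: "3 \<le> l" and \<alpha>: "\<alpha> \<noteq> 0" and inv: "invertible A"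
    and eq: "lin_subst A (C_tilde d l \<alpha> \<beta>) = const c * C_tilde d l \<alpha> \<beta>"
  shows "A $ 1 $ 2 = 0" "A $ 3 $ 2 = 0" "A $ 2 $ 1 = 0" "A $ 2 $ 3 = 0" "A $ 2 $ 2 \<noteq> 0"
proof -
  let ?G = "C_tilde d l \<alpha> \<beta>"
  define a b where "a = d - 2" and "b = d - 3"
  have d_eq: "d = Suc (Suc a)" "d = Suc (Suc (Suc b))" "a = Suc b" and "2 \<le> b"
    using d by (simp_all add: a_def b_def)
  have l2: "\<not> l dvd Suc (Suc 0)" "\<not> l dvd Suc 0"
    using l by (auto dest: dvd_imp_le)
  have rel: "A $ 2 $ 2 * A $ 2 $ i = 0" "A $ 1 $ 2 * A $ 1 $ i = 0"
    "A $ 1 $ 2 * A $ 3 $ i + A $ 3 $ 2 * A $ 1 $ i = 0" "A $ 3 $ 2 * A $ 3 $ i = 0"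
    if i: "i = 1 \<or> i = 3" for i
  proof -
    define S where "S = (\<Sum>p\<in>UNIV. \<Sum>q\<in>UNIV. const (A $ p $ 2 * A $ q $ i) * pderiv3 q (pderiv3 p ?G))"
    have "lin_subst A S = pderiv3 i (pderiv3 2 (lin_subst A ?G))"
      by (simp add: S_def pderiv3_lin_subst lin_subst_sum sum_distrib_left mult.assoc)
    also have "\<dots> = 0"
      using d i by (simp add: eq pderiv3_pderiv3_C_tilde)
    finally have "S = 0"
      using inv by (simp add: lin_subst_eq_0_iff)
    then have S: "(\<Sum>p\<in>UNIV. \<Sum>q\<in>UNIV. (A $ p $ 2 * A $ q $ i) *
        Poly_Mapping.lookup (pderiv3 q (pderiv3 p ?G)) m) = 0" for m
    proof -
      have "Poly_Mapping.lookup S m = 0"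
        by (simp only: \<open>S = 0\<close> lookup_zero)
      then show ?thesis
        by (simp only: S_def lookup_sum lookup_const_mult)
    qed
    note S' = S[unfolded sum_3, of "mon3 _ _ _", unfolded lookup_pderiv3_mon3 lookup_C_tilde]
    have nz: "of_nat (Suc n) \<noteq> (0::'a)" for n
      by (simp only: of_nat_eq_0_iff nat.simps not_False_eq_True)
    have of1: "of_nat (Suc 0) = (1 :: 'a)"
      by simp
    \<comment> \<open>The four relations are read off at the monomials \<open>Y^(d-2)\<close>,
      \<open>X^(d-2)\<close>, \<open>Z^(d-2)\<close> and \<open>X Z^(d-3)\<close> of
      \<open>S\<close>. The second uses that \<open>X^(d-2) Z^2\<close> is absent since
      \<open>l\<close> is at least 3; the last two use earlier relations to remove the unknown
      \<beta> terms.\<close>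
    show r1: "A $ 2 $ 2 * A $ 2 $ i = 0"
      using S'[of 0 a 0] nz \<open>2 \<le> b\<close> by (simp add: d_eq(2,3) del: of_nat_Suc)
    show r2: "A $ 1 $ 2 * A $ 1 $ i = 0"
      using S'[of a 0 0] nz \<open>2 \<le> b\<close> l2 by (simp add: d_eq(2,3) del: of_nat_Suc)
    show r3: "A $ 1 $ 2 * A $ 3 $ i + A $ 3 $ 2 * A $ 1 $ i = 0"
    proof -
      have "(A $ 1 $ 2 * A $ 3 $ i + A $ 3 $ 2 * A $ 1 $ i) * (of_nat (Suc (Suc b)) * \<alpha>) = 0"
        using S'[of 0 0 a] \<open>2 \<le> b\<close> r2 by (auto simp: d_eq(2,3) of1 algebra_simps simp del: of_nat_Suc)
      then show ?thesis
        using nz[of "Suc b"] \<alpha> by (simp del: of_nat_Suc)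
    qed
    show "A $ 3 $ 2 * A $ 3 $ i = 0"
      using S'[of 1 0 b] nz \<open>2 \<le> b\<close> \<alpha> r2 r3 by (auto simp: d_eq(2,3) of1 simp del: of_nat_Suc)
  qed
  have det: "det A \<noteq> 0"
    using inv by (simp add: invertible_det_nz)
  \<comment> \<open>If this entry or \<open>A $ 3 $ 2\<close> were nonzero, the relations would
    leave only the second entry in columns 1 and 3, making them proportional.\<close>
  show 12: "A $ 1 $ 2 = 0"
    using rel[of 1] rel[of 3] det by (auto simp: det_3)
  show 32: "A $ 3 $ 2 = 0"
    using rel[of 1] rel[of 3] det 12 by (auto simp: det_3)
  show 22: "A $ 2 $ 2 \<noteq> 0"
    using det 12 32 by (auto simp: det_3)
  show "A $ 2 $ 1 = 0" "A $ 2 $ 3 = 0"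
    using rel(1)[of 1] rel(1)[of 3] 22 by auto
qed

section \<open>Matrices representing projective classes\<close>

lemma mem_proj_class: "B \<in> proj_class A \<longleftrightarrow> (\<exists>s. s \<noteq> 0 \<and> B = mat s ** A)"
  by (auto simp: proj_class_def r_coset_def scalars3_def GL3_def)

lemma proj_class_scale:
  assumes "s \<noteq> 0"
  shows "proj_class (mat s ** A) = proj_class A"
proof (rule equalityI; rule subsetI)
  fix B assume "B \<in> proj_class (mat s ** A)"
  then obtain t where "t \<noteq> 0" "B = mat t ** (mat s ** A)"
    unfolding mem_proj_class by blast
  then show "B \<in> proj_class A"
    unfolding mem_proj_class using assms
    by (intro exI[of _ "t * s"]) (simp add: matrix_mul_assoc mat_mult)
next
  fix B assume "B \<in> proj_class A"
  then obtain t where "t \<noteq> 0" "B = mat t ** A"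
    unfolding mem_proj_class by blast
  then show "B \<in> proj_class (mat s ** A)"
    unfolding mem_proj_class using assms
    by (intro exI[of _ "t / s"]) (simp add: matrix_mul_assoc mat_mult)
qed

lemma proj_class_eq_one_iff: "proj_class B = proj_class (mat 1) \<longleftrightarrow> (\<exists>s. s \<noteq> 0 \<and> B = mat s)"
proof
  assume eq: "proj_class B = proj_class (mat 1)"
  have "B \<in> proj_class B"
    unfolding mem_proj_class by (intro exI[of _ 1]) simp
  with eq show "\<exists>s. s \<noteq> 0 \<and> B = mat s"
    by (simp add: mem_proj_class)
next
  assume "\<exists>s. s \<noteq> 0 \<and> B = mat s"
  then obtain s where "s \<noteq> 0" "B = mat s"
    by blast
  then show "proj_class B = proj_class (mat 1)"
    using proj_class_scale[of s "mat 1"] by simp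
qed

lemma curve_aut_C_tilde:
  fixes \<alpha> :: "'a::field_char_0"
  assumes "5 \<le> d" "3 \<le> l" "\<alpha> \<noteq> 0" "g \<in> carrier (curve_aut (C_tilde d l \<alpha> \<beta>))"
  shows "\<exists>\<alpha>\<^sub>1 \<alpha>\<^sub>3 \<gamma>\<^sub>1 \<gamma>\<^sub>2. g = proj_class (vector [vector [\<alpha>\<^sub>1, 0, \<alpha>\<^sub>3],
      vector [0, 1, 0], vector [\<gamma>\<^sub>1, 0, \<gamma>\<^sub>2]])"
proof -
  obtain A where A: "g = proj_class A" "invertible A" "preserves_curve A (C_tilde d l \<alpha> \<beta>)"
    using assms(4) by (auto simp: curve_aut_def)
  then obtain c where "lin_subst A (C_tilde d l \<alpha> \<beta>) = const c * C_tilde d l \<alpha> \<beta>"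
    by (auto simp: preserves_curve_def)
  note z = linear_automorphism_C_tilde[OF assms(1-3) A(2) this]
  \<comment> \<open>The representative is rescaled so that its middle entry is 1.\<close>
  let ?s = "inverse (A $ 2 $ 2)"
  have "mat ?s ** A = vector [vector [?s * A $ 1 $ 1, 0, ?s * A $ 1 $ 3], vector [0, 1, 0],
      vector [?s * A $ 3 $ 1, 0, ?s * A $ 3 $ 3]]"
    using z by (simp add: mat_mult_left vec_eq_iff forall_3)
  then show ?thesis
    using A(1) z proj_class_scale[of ?s A] by (metis inverse_nonzero_iff_nonzero)
qed

section \<open>Reduction to the normal form\<close>

lemma funpow_matrix_vector:
  "((**) A ^^ M) (mat 1) *v v = ((*v) A ^^ M) v"
  for A :: "'a::comm_semiring_1 ^ 'n ^ 'n"
  by (induction M) (simp_all add: matrix_vector_mul_assoc[symmetric])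

text \<open>Powers in the quotient are represented by iterated matrix products, which
  \<open>funpow_matrix_vector\<close> relates to the iterated action on vectors.\<close>

lemma proj_class_pow:
  assumes "invertible A"
  shows "invertible (((**) A ^^ M) (mat 1))"
    and "proj_class A [^]\<^bsub>PGL3\<^esub> M = proj_class (((**) A ^^ M) (mat 1))"
proof -
  show inv: "invertible (((**) A ^^ M) (mat 1))" for M
    using assms by (induction M) (simp_all add: invertible_mat invertible_mult)
  interpret group PGL3
    by (rule group_PGL3)
  have "proj_class A \<in> carrier PGL3"
    using assms by (auto simp: carrier_PGL3)
  then show "proj_class A [^]\<^bsub>PGL3\<^esub> M = proj_class (((**) A ^^ M) (mat 1))"
  proof (induction M)
    case (Suc M)
    have "proj_class A [^]\<^bsub>PGL3\<^esub> Suc M = proj_class A \<otimes>\<^bsub>PGL3\<^esub> proj_class A [^]\<^bsub>PGL3\<^esub> M"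
      using Suc.prems by (rule nat_pow_Suc2)
    then show ?case
      using Suc assms inv by (simp add: mult_PGL3)
  qed (simp add: one_PGL3)
qed

lemma cyclic_group_generator:
  assumes "group G" "cyclic_group G"
  obtains x where "x \<in> carrier G" "\<And>M :: nat. x [^]\<^bsub>G\<^esub> M = \<one>\<^bsub>G\<^esub> \<longleftrightarrow> card (carrier G) dvd M"
proof -
  interpret group G
    by fact
  obtain x where x: "x \<in> carrier G" "subgroup_generated G {x} = G"
    using assms(2) by (auto simp: cyclic_group_def)
  then have "carrier G = generate G {x}"
    by (metis Int_insert_right_if1 Int_empty_right carrier_subgroup_generated)
  then have "ord x = card (carrier G)"
    using generate_pow_card[OF x(1)] by simp
  with that x show thesis
    using pow_eq_id by metis
qed

text \<open>A generator has order \<open>card H\<close>, and a power of its class is trivial exactly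
  when the matrix power is scalar. Stating this through the action on vectors prepares the use of
  eigenvectors.\<close>

lemma cyclic_subgroup_matrix:
  assumes H: "subgroup H (curve_aut F)" "cyclic_group ((curve_aut F)\<lparr>carrier := H\<rparr>)"
  obtains A c where "invertible A" "c \<noteq> 0" "lin_subst A F = const c * F"
    "\<And>M. (\<exists>t. \<forall>v. ((*v) A ^^ M) v = t *s v) \<longleftrightarrow> card H dvd M"
proof -
  let ?K = "(curve_aut F)\<lparr>carrier := H\<rparr>"
  obtain g where g: "g \<in> H" "\<And>M :: nat. g [^]\<^bsub>?K\<^esub> M = \<one>\<^bsub>?K\<^esub> \<longleftrightarrow> card H dvd M"
    using cyclic_group_generator[OF subgroup.subgroup_is_group[OF H(1) group_curve_aut] H(2)] by auto
  then have "g \<in> carrier (curve_aut F)"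
    using H(1) by (meson subgroup.mem_carrier)
  then obtain A c where A: "g = proj_class A" "invertible A" and c: "c \<noteq> 0" "lin_subst A F = const c * F"
    by (auto simp: curve_aut_def preserves_curve_def)
  have "(\<exists>t. \<forall>v. ((*v) A ^^ M) v = t *s v) \<longleftrightarrow> card H dvd M" for M
  proof -
    let ?B = "((**) A ^^ M) (mat 1)"
    have mat: "mat t *v v = t *s v" for t :: 'a and v :: "'a ^ 3"
      by (simp add: matrix_vector_mult_def mat_def vec_eq_iff if_distrib[of "\<lambda>x. x * y" for y] cong: if_cong)
    have "g [^]\<^bsub>?K\<^esub> M = g [^]\<^bsub>PGL3\<^esub> M" "\<one>\<^bsub>?K\<^esub> = \<one>\<^bsub>PGL3\<^esub>"
      by (simp_all add: curve_aut_def nat_pow_def)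
    then have "card H dvd M \<longleftrightarrow> proj_class ?B = proj_class (mat 1)"
      using g(2)[of M] A by (simp add: proj_class_pow one_PGL3)
    also have "\<dots> \<longleftrightarrow> (\<exists>t. t \<noteq> 0 \<and> ?B = mat t)"
      by (rule proj_class_eq_one_iff)
    \<comment> \<open>Powers of \<open>A\<close> are invertible, so a scalar power has a nonzero
      scalar.\<close>
    also have "\<dots> \<longleftrightarrow> (\<exists>t. ?B = mat t)"
    proof -
      have "\<not> invertible (mat 0 :: 'a ^ 3 ^ 3)"
        by (simp add: invertible_det_nz mat_def det_3)
      then show ?thesis
        using proj_class_pow(1)[OF A(2), of M] by metis
    qed
    also have "\<dots> \<longleftrightarrow> (\<exists>t. \<forall>v. ?B *v v = mat t *v v)"
      by (metis matrix_eq)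
    finally show ?thesis
      by (simp add: funpow_matrix_vector mat)
  qed
  with A c show thesis
    by (intro that)
qed

text \<open>In degree \<open>d\<close>, \<open>d dvd j\<close> leaves only \<open>Y^d\<close> or
  \<open>j = 0\<close>. In the latter case \<open>k\<close> is a multiple of \<open>l\<close>, which
  excludes 1 and \<open>d\<close> because \<open>l\<close> divides \<open>d - 1\<close>;
  \<open>k = d - 1\<close> gives the \<alpha> term and \<open>k\<close> from 2 to
  \<open>d - 2\<close> the \<beta> terms.\<close>

lemma C_tilde_eqI:
  assumes d: "5 \<le> d" and l: "3 \<le> l" "l dvd d - 1" and hom: "homogeneous3 d G"
    and X: "Poly_Mapping.lookup G (mon3 d 0 0) = 1" and Y: "Poly_Mapping.lookup G (mon3 0 d 0) = 1"
    and supp: "\<And>i j k. Poly_Mapping.lookup G (mon3 i j k) \<noteq> 0 \<Longrightarrow> d dvd j \<and> l dvd k"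
  shows "G = C_tilde d l (Poly_Mapping.lookup G (mon3 1 0 (d - 1)))
    (\<lambda>k. Poly_Mapping.lookup G (mon3 (d - k) 0 k))" (is "G = ?C")
proof (rule poly_mapping_eqI)
  fix m
  obtain i j k where m: "m = mon3 i j k"
    by (rule mon3_cases)
  have l_dvd: "\<not> l dvd d" "\<not> l dvd 1"
  proof -
    show 1: "\<not> l dvd 1"
      using l by simp
    have "d = (d - 1) + 1"
      using d by simp
    then show "\<not> l dvd d"
      using 1 l(2) by (metis dvd_add_right_iff)
  qed
  have sum: "i + j + k = d" if "Poly_Mapping.lookup G m \<noteq> 0"
  proof -
    have "m \<in> Poly_Mapping.keys G"
      using that by (simp add: in_keys_iff)
    with hom show ?thesis
      unfolding homogeneous3_def m by (auto simp: sum_3)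
  qed
  show "Poly_Mapping.lookup G m = Poly_Mapping.lookup ?C m"
  proof (cases "Poly_Mapping.lookup G m = 0")
    case True
    then have "\<not> (i = d \<and> j = 0 \<and> k = 0)" "\<not> (i = 0 \<and> j = d \<and> k = 0)"
      using X Y True by (metis m zero_neq_one)+
    with True show ?thesis
      using d by (auto simp: m lookup_C_tilde)
  next
    case False
    then have dvd: "d dvd j" "l dvd k"
      using supp by (auto simp: m)
    show ?thesis
    proof (cases "j = 0")
      case True
      have "k \<noteq> d" "k \<noteq> 1"
        using dvd l_dvd by auto
      then consider "k = 0" | "2 \<le> k" "k \<le> d - 2" | "k = d - 1"
        using sum[OF False] by linarith
      then show ?thesis
        using True sum[OF False] d X dvd by cases (auto simp: m lookup_C_tilde)
    next
      case 2: False
      then have "j = d"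
        using dvd sum[OF False] by (metis add.commute dvd_imp_le le_add1 le_antisym le_trans not_gr_zero)
      then show ?thesis
        using sum[OF False] d Y by (auto simp: m lookup_C_tilde)
    qed
  qed
qed

text \<open>The isomorphism is the matrix whose columns are eigenvectors of a generator, suitably
  permuted and rescaled.\<close>

lemma isomorphic_to_C_tilde:
  fixes F :: "'a::{alg_closed_field, field_char_0} poly3"
  assumes d: "5 \<le> d" and l: "3 \<le> l" "l dvd d - 1" and ns: "nonsingular_plane_curve d F"
    and H: "subgroup H (curve_aut F)" "cyclic_group ((curve_aut F)\<lparr>carrier := H\<rparr>)" "card H = l * d"
  shows "\<exists>\<alpha> \<beta>. \<alpha> \<noteq> 0 \<and> curves_isomorphic F (C_tilde d l \<alpha> \<beta>)"
proof -
  have hom: "homogeneous3 d F"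
    using ns by (simp add: nonsingular_plane_curve_def)
  obtain A c where A: "invertible A" and c: "c \<noteq> 0" "lin_subst A F = const c * F"
    and pow: "\<And>M. (\<exists>t. \<forall>v. ((*v) A ^^ M) v = t *s v) \<longleftrightarrow> card H dvd M"
    using cyclic_subgroup_matrix[OF H(1,2)] by blast
  note pow = pow[unfolded H(3)]
  obtain s where s: "\<And>v. ((*v) A ^^ (l * d)) v = s *s v"
    using pow[of "l * d"] by auto
  obtain B where B: "B ** A = mat 1"
    using A by (auto simp: invertible_left_inverse)
  have inj: "v = 0" if "A *v v = 0" for v
    using that B by (metis matrix_left_invertible_ker)
  have pow_inj: "v = 0" if "((*v) A ^^ M) v = 0" for M v
    using that by (induction M) (auto dest: inj)
  have "s \<noteq> 0"
  proof
    assume "s = 0"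
    then have "axis 1 1 = (0 :: 'a ^ 3)"
      using s by (simp add: pow_inj[of "l * d" "axis 1 1"])
    then show False
      by (simp add: axis_eq_0_iff)
  qed
  then have "vec.span {w. \<exists>t. A *v w = t *s w} = UNIV"
    using s d l by (intro span_eigenvectors[of "l * d" s]) auto
  then obtain b :: "3 \<Rightarrow> 'a ^ 3" and e where inv: "invertible (column_matrix b)" and b: "\<And>j. A *v b j = e j *s b j"
    by (rule eigenbasis_exists) blast
  have nz: "e j \<noteq> 0" for j
  proof
    assume "e j = 0"
    then have "b j = 0"
      using b[of j] inj[of "b j"] by simp
    then have "(\<Sum>i\<in>UNIV. (if i = j then 1 else 0) *s b i) = 0"
      by (intro sum.neutral) auto
    from inv[unfolded invertible_column_matrix_iff, rule_format, OF this, of j] show False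
      by simp
  qed
  \<comment> \<open>If all eigenvalues have the same \<open>M\<close>-th power, then the
    \<open>M\<close>-th power of \<open>A\<close> acts as a scalar on a basis, hence
    everywhere.\<close>
  have ord: "l * d dvd M" if "\<And>i. e i ^ M = t" for M t
  proof -
    have "((*v) A ^^ M) v = t *s v" for v
    proof -
      obtain C where C: "column_matrix b ** C = mat 1"
        using inv by (auto simp: invertible_right_inverse)
      have v: "v = (\<Sum>j\<in>UNIV. (C *v v) $ j *s b j)"
        unfolding column_matrix_vector_mult[symmetric] by (simp add: matrix_vector_mul_assoc C)
      have "((*v) A ^^ M) v = (\<Sum>j\<in>UNIV. ((C *v v) $ j * t) *s b j)"
        by (subst v, subst funpow_eigenvectors[where e = e, OF b]) (simp add: that)
      also have "\<dots> = t *s v"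
        by (subst (2) v) (simp add: vec.scale_sum_right mult.commute)
      finally show ?thesis .
    qed
    then show ?thesis
      using pow by blast
  qed
  note rel = eigenvalue_relations[where b = b and e = e, OF hom c(2) b]
  obtain x y z where dist: "x \<noteq> y" "y \<noteq> z" "x \<noteq> z"
    and off: "eval3 F (b x) \<noteq> 0" "eval3 F (b y) \<noteq> 0" and tan: "directional F (b z) (b x) \<noteq> 0"
    by (rule vertex_configuration[where off = "\<lambda>i. eval3 F (b i) \<noteq> 0" and c = c and
          tgt = "\<lambda>i k. directional F (b i) (b k) \<noteq> 0", OF d l nz ord rel])
      (use nonsingular_column_matrix[OF ns _ inv] d in auto)
  \<comment> \<open>The two vertices off the curve become those of \<open>X\<close> and
    \<open>Y\<close>, and the remaining one that of \<open>Z\<close>.\<close>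
  define \<pi> :: "3 \<Rightarrow> 3" where "\<pi> j = (if j = 1 then x else if j = 2 then y else z)" for j
  have \<pi>_simps [simp]: "\<pi> 1 = x" "\<pi> 2 = y" "\<pi> 3 = z"
    by (simp_all add: \<pi>_def)
  have "inj \<pi>"
    unfolding inj_def forall_3 using dist by simp
  then have \<pi>: "bij \<pi>"
    by (simp add: bij_def finite_UNIV_inj_surj)
  \<comment> \<open>Rescaling by these \<open>d\<close>-th roots gives \<open>X^d\<close> and
    \<open>Y^d\<close> the coefficient 1. The third vector keeps its scale, since \<alpha> need only
    be nonzero.\<close>
  obtain s1 where s1: "s1 ^ d = inverse (eval3 F (b x))"
    using d nth_root_exists[of d] by (metis gr0I not_numeral_le_zero)
  obtain s2 where s2: "s2 ^ d = inverse (eval3 F (b y))"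
    using d nth_root_exists[of d] by (metis gr0I not_numeral_le_zero)
  define r where "r j = (if j = 1 then s1 else if j = 2 then s2 else 1)" for j :: 3
  have r_simps [simp]: "r 1 = s1" "r 2 = s2" "r 3 = 1"
    by (simp_all add: r_def)
  have r0: "r j \<noteq> 0" for j
    using s1 s2 off d by (auto simp: r_def power_0_left)
  define b' where "b' j = r j *s b (\<pi> j)" for j
  define e' where "e' j = e (\<pi> j)" for j
  define G where "G = lin_subst (column_matrix b') F"
  have b': "A *v b' j = e' j *s b' j" for j
    by (simp add: b'_def e'_def vec.scale b mult.commute)
  have inv': "invertible (column_matrix b')"
    unfolding b'_def by (rule invertible_column_matrix_reindex[OF inv \<pi> r0])
  have X: "Poly_Mapping.lookup G (mon3 d 0 0) = 1"
    using lookup_lin_subst_column_matrix[OF hom, of b' 1] off s1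
    by (simp add: G_def b'_def eval3_scale[OF hom] single_eq_mon3)
  have Y: "Poly_Mapping.lookup G (mon3 0 d 0) = 1"
    using lookup_lin_subst_column_matrix[OF hom, of b' 2] off s2
    by (simp add: G_def b'_def eval3_scale[OF hom] single_eq_mon3)
  have "Poly_Mapping.lookup G (mon3 1 0 (d - 1)) = directional F (b' 3) (b' 1)"
    using lookup_lin_subst_column_matrix_add[OF hom, of 3 1 b']
    by (simp add: G_def single_eq_mon3 mon3_add)
  also have "\<dots> = s1 * directional F (b z) (b x)"
    by (simp add: directional_def b'_def sum_distrib_left mult.assoc)
  finally have Z: "Poly_Mapping.lookup G (mon3 1 0 (d - 1)) \<noteq> 0"
    using tan r0[of 1] by simp
  have prod3: "(\<Prod>i\<in>UNIV. f i) = f 1 * f 2 * f 3" for f :: "3 \<Rightarrow> 'a"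
    unfolding UNIV_3 by (simp add: mult.assoc)
  have supp: "d dvd j \<and> l dvd k" if "Poly_Mapping.lookup G (mon3 i j k) \<noteq> 0" for i j k
  proof -
    have mono: "e' 1 ^ i * e' 2 ^ j * e' 3 ^ k = c" if "Poly_Mapping.lookup G (mon3 i j k) \<noteq> 0" for i j k
      using lin_subst_eigenbasis[where b = b' and e = e', OF c(2) b' that[unfolded G_def]]
      by (simp only: prod3 lookup_mon3)
    have "mon3 i j k \<in> Poly_Mapping.keys G"
      using that by (simp add: in_keys_iff)
    with homogeneous3_lin_subst[OF hom, of "column_matrix b'"] have ijk: "i + j + k = d"
      unfolding homogeneous3_def G_def by (auto simp: sum_3)
    \<comment> \<open>After division by \<open>e' 1\<close> the automorphism is
      \<open>diag(1, u, w)\<close>. The monomials \<open>X^d\<close>, \<open>Y^d\<close> and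
      \<open>X Z^(d-1)\<close> give \<open>u ^ d = 1\<close> and
      \<open>w ^ (d - 1) = 1\<close>.\<close>
    define u w where "u = e' 2 / e' 1" and "w = e' 3 / e' 1"
    have e1: "e' 1 \<noteq> 0" "e' 1 ^ d = c" "e' 2 ^ d = c"
      using mono[of d 0 0] mono[of 0 d 0] X Y nz by (simp_all add: e'_def)
    have e3: "e' 3 ^ (d - 1) * e' 1 = c"
      using mono[of 1 0 "d - 1"] Z by (simp add: mult.commute)
    have dd: "e' 1 ^ (d - 1) * e' 1 = c"
      using power_minus_mult[of d "e' 1"] d e1 by simp
    have u: "u ^ d = 1"
      using e1 c by (simp add: u_def power_divide)
    have w: "w ^ (d - 1) = 1"
    proof -
      have "e' 3 ^ (d - 1) = e' 1 ^ (d - 1)"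
        using e1(1) e3 dd by (metis mult_right_cancel)
      then show ?thesis
        using e1(1) by (simp add: w_def power_divide)
    qed
    \<comment> \<open>Any occurring monomial has eigenvalue \<open>c = e' 1 ^ d\<close>, so its
      normalised eigenvalue is 1.\<close>
    have "u ^ j * w ^ k = (e' 1 ^ i * e' 2 ^ j * e' 3 ^ k) / e' 1 ^ (i + j + k)"
      using e1(1) by (simp add: u_def w_def power_divide power_add)
    also have "\<dots> = 1"
      unfolding ijk mono[OF that] e1(2) using c(1) by simp
    finally have uw: "u ^ j * w ^ k = 1" .
    have "l * d dvd M" if "u ^ M = 1" "w ^ M = 1" for M
    proof (rule ord[of M "e' 1 ^ M"])
      fix q
      have "surj \<pi>"
        using \<pi> by (rule bij_is_surj)
      then obtain p where p: "q = \<pi> p"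
        by (rule surjE)
      show "e q ^ M = e' 1 ^ M"
        using that nz exhaust_3[of p] unfolding p by (auto simp: u_def w_def e'_def power_divide)
    qed
    note ord' = this
    have "0 < l" "1 < d"
      using l d by simp_all
    then show ?thesis
      using diagonal_exponents_dvd[OF _ l(2) _ ord' u w uw] by blast
  qed
  have homG: "homogeneous3 d G"
    unfolding G_def by (rule homogeneous3_lin_subst[OF hom])
  have "G = C_tilde d l (Poly_Mapping.lookup G (mon3 1 0 (d - 1)))
      (\<lambda>k. Poly_Mapping.lookup G (mon3 (d - k) 0 k))"
    by (rule C_tilde_eqI[OF d l homG X Y supp])
  then obtain \<alpha> \<beta> where "\<alpha> \<noteq> 0" "G = C_tilde d l \<alpha> \<beta>"
    using Z by blast
  then have "curves_isomorphic F (C_tilde d l \<alpha> \<beta>)"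
    unfolding curves_isomorphic_def using inv'
    by (intro exI[of _ "column_matrix b'"] exI[of _ 1]) (simp add: G_def)
  with \<open>\<alpha> \<noteq> 0\<close> show ?thesis
    by blast
qed

theorem proposition57:
  fixes F :: "'k::{alg_closed_field, field_char_0} poly3"
    and d l :: nat
  assumes "5 \<le> d" and "3 \<le> l" and "l \<le> d - 1" and "[d = 1] (mod l)"
    and "nonsingular_plane_curve d F"
    and "\<exists>H. subgroup H (curve_aut F) \<and>
             cyclic_group ((curve_aut F)\<lparr>carrier := H\<rparr>) \<and> card H = l * d"
  shows "\<exists>(\<alpha>::'k) (\<beta>::nat \<Rightarrow> 'k).
           \<alpha> \<noteq> 0 \<and>
           curves_isomorphic F (C_tilde d l \<alpha> \<beta>) \<and>
           (\<forall>g\<in>carrier (curve_aut (C_tilde d l \<alpha> \<beta>)).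
              \<exists>\<alpha>\<^sub>1 \<alpha>\<^sub>3 \<gamma>\<^sub>1 \<gamma>\<^sub>2.
                g = proj_class (vector [vector [\<alpha>\<^sub>1, 0, \<alpha>\<^sub>3],
                                        vector [0, 1, 0],
                                        vector [\<gamma>\<^sub>1, 0, \<gamma>\<^sub>2]]))"
proof -
  have "l dvd d - 1"
    using assms(1,4) by (simp add: cong_altdef_nat)
  then obtain \<alpha> :: 'k and \<beta> where "\<alpha> \<noteq> 0" "curves_isomorphic F (C_tilde d l \<alpha> \<beta>)"
    using isomorphic_to_C_tilde[OF assms(1,2) _ assms(5)] assms(6) by blast
  then show ?thesis
    using curve_aut_C_tilde[OF assms(1,2)] by blast
qed

end
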